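(* Let $n\ge 1$ and let $X^{n,n+1}_{n+3}$ be the blow-up of $\mathbb{P}^n\times\mathbb{P}^{n+1}$ in $n+3$ points $p_1,\dots,p_{n+3}$ in general position. Let $C$ be the distinguished rational curve through $p_1,\dots,p_{n+3}$, let $1\le k\le n+1$ and $1\le l\le n+1$, and let $i_1,\dots,i_l\in\{1,\dots,n+3\}$ be distinct. The (strict transform in $X^{n,n+1}_{n+3}$ of the) bilinear join $\operatorname{BJ}(\operatorname{BS}_k(C),\operatorname{BL}(p_{i_1},\dots,p_{i_l}))$ of the $k$-th bilinear secant variety $\operatorname{BS}_k(C)$ and the bilinear span $\operatorname{BL}(p_{i_1},\dots,p_{i_l})$ is contained in the base locus of an effective divisor $D=d_1H_1+d_2H_2-\sum_{i=1}^{n+3}m_iE_i$ at least $$\max\Big\{0,\;k\sum_{i=1}^{n+3}m_i+\sum_{j=1}^{l}m_{i_j}-(nk+k+l-1)d_1-(nk+2k+l-1)d_2\Big\}$$ times.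
   Context: We work over an algebraically closed field of characteristic zero. $H_1,H_2$ are the pullbacks of the hyperplane classes of the two factors and $E_i$ is the exceptional divisor over $p_i$. The distinguished rational curve $C$ is the unique irreducible curve of bidegree $(n,n+1)$ in $\mathbb{P}^n\times\mathbb{P}^{n+1}$ through $p_1,\dots,p_{n+3}$ (it exists and is smooth and rational; bidegree $(a,b)$ means intersection numbers $a$ and $b$ with the pullbacks of hyperplanes from the first and second factor). For points $z_1,\dots,z_r$ whose projections to each factor are linearly independent ("general" points), the bilinear span is $\operatorname{BL}(z_1,\dots,z_r)=L^1\times L^2$, where $L^j$ is the linear span of the projections to the $j$-th factor. The bilinear join of subvarieties $X_1,\dots,X_r$ is $\operatorname{BJ}(X_1,\dots,X_r)=\overline{\bigcup_{z_i\in X_i}\operatorname{BL}(z_1,\dots,z_r)}$, the union over $r$-tuples of general points, and $\operatorname{BS}_k(C)=\operatorname{BJ}(C,\dots,C)$ ($k$ copies). The statement that $V$ is contained in the base locus of $D$ at least $m$ times means that every effective divisor in $|D|$ has multiplicity at least $m$ along $V$ (at a general point of $V$; if $V$ is the whole variety this multiplicity is $0$). *)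

theory Defs
  imports
    "HOL-Library.Poly_Mapping"
    "HOL-Library.Function_Algebras"
    "HOL-Computational_Algebra.Computational_Algebra"
begin

text \<open>
  Polynomials in variables of type \<open>'v\<close> are finitely supported maps from monomials to
  coefficients, with the ring structure of \<^theory>\<open>HOL-Library.Poly_Mapping\<close>.
\<close>

type_synonym ('v, 'a) mpoly = "('v \<Rightarrow>\<^sub>0 nat) \<Rightarrow>\<^sub>0 'a"

definition Const :: "'a::zero \<Rightarrow> ('v, 'a) mpoly"
  where "Const c = Poly_Mapping.single 0 c"

definition Var :: "'v \<Rightarrow> ('v, 'a::zero_neq_one) mpoly"
  where "Var v = Poly_Mapping.single (Poly_Mapping.single v 1) 1"

text \<open>Substitution of \<open>\<sigma>\<close> for the variables, coefficients being mapped by \<open>h\<close>.\<close>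

definition msubst :: "('a::zero \<Rightarrow> 'b::comm_ring_1) \<Rightarrow> ('v \<Rightarrow> 'b) \<Rightarrow> ('v, 'a) mpoly \<Rightarrow> 'b"
  where "msubst h \<sigma> F = (\<Sum>\<mu>\<in>Poly_Mapping.keys F.
           h (Poly_Mapping.lookup F \<mu>) *
           (\<Prod>v\<in>Poly_Mapping.keys \<mu>. \<sigma> v ^ Poly_Mapping.lookup \<mu> v))"

definition mdegree :: "('v \<Rightarrow>\<^sub>0 nat) \<Rightarrow> nat"
  where "mdegree \<mu> = (\<Sum>v\<in>Poly_Mapping.keys \<mu>. Poly_Mapping.lookup \<mu> v)"

text \<open>
  Order of vanishing at the affine point \<open>z\<close>: the lowest degree of a term of the Taylor
  expansion at \<open>z\<close>.  Only used for \<open>F \<noteq> 0\<close>.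
\<close>

definition order_at :: "('v \<Rightarrow> 'a::comm_ring_1) \<Rightarrow> ('v, 'a) mpoly \<Rightarrow> nat"
  where "order_at z F =
           Min (mdegree ` Poly_Mapping.keys (msubst Const (\<lambda>v. Const (z v) + Var v) F))"


section \<open>The product of two projective spaces\<close>

type_synonym 'a vec = "nat \<Rightarrow> 'a"
type_synonym 'a point = "'a vec \<times> 'a vec"

definition vscale :: "'a::field \<Rightarrow> 'a vec \<Rightarrow> 'a vec"
  where "vscale c x = (\<lambda>i. c * x i)"

interpretation fv: vector_space vscale
  by standard (auto simp: vscale_def fun_eq_iff algebra_simps)

text \<open>
  Points are given by homogeneous coordinates \<open>x\<^sub>0, \<dots>, x\<^sub>N\<close>, and vectors are extended by zero beyond
  index \<open>N\<close>.  A subset of the product is represented by the set of all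
  coordinate vectors of its points, so it is closed under separate rescaling of the two factors.
\<close>

definition coord_space :: "nat \<Rightarrow> 'a::field vec set"
  where "coord_space N = {x. \<forall>i>N. x i = 0}"

definition PP :: "nat \<Rightarrow> 'a::field point set"
  where "PP n = (coord_space n - {0}) \<times> (coord_space (n + 1) - {0})"

definition same_point :: "'a::field point \<Rightarrow> 'a point \<Rightarrow> bool"
  where "same_point z w \<longleftrightarrow>
           (\<exists>c e. c \<noteq> 0 \<and> e \<noteq> 0 \<and> fst z = vscale c (fst w) \<and> snd z = vscale e (snd w))"

text \<open>The variable \<open>Inl i\<close> is \<open>x\<^sub>i\<close> and \<open>Inr j\<close> is \<open>y\<^sub>j\<close>.\<close>

abbreviation coords :: "'a point \<Rightarrow> nat + nat \<Rightarrow> 'a"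
  where "coords z \<equiv> case_sum (fst z) (snd z)"

definition bihomogeneous :: "nat \<Rightarrow> int \<Rightarrow> int \<Rightarrow> (nat + nat, 'a::zero) mpoly \<Rightarrow> bool"
  where "bihomogeneous n d1 d2 F \<longleftrightarrow>
           (\<forall>\<mu>\<in>Poly_Mapping.keys F.
              Poly_Mapping.keys \<mu> \<subseteq> Inl ` {..n} \<union> Inr ` {..n + 1} \<and>
              int (\<Sum>i\<le>n. Poly_Mapping.lookup \<mu> (Inl i)) = d1 \<and>
              int (\<Sum>j\<le>n + 1. Poly_Mapping.lookup \<mu> (Inr j)) = d2)"

definition zariski_closure :: "nat \<Rightarrow> 'a::field point set \<Rightarrow> 'a point set"
  where "zariski_closure n S =
           {z \<in> PP n. \<forall>d1 d2 F. bihomogeneous n d1 d2 F \<and> (\<forall>w\<in>S. msubst id (coords w) F = 0)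
                        \<longrightarrow> msubst id (coords z) F = 0}"


section \<open>General position, bilinear spans and joins\<close>

definition lin_indep :: "'a::field vec list \<Rightarrow> bool"
  where "lin_indep xs \<longleftrightarrow> distinct xs \<and> fv.independent (set xs)"

definition general_points :: "'a::field point list \<Rightarrow> bool"
  where "general_points zs \<longleftrightarrow> lin_indep (map fst zs) \<and> lin_indep (map snd zs)"

text \<open>
  The points \<open>p 1, \<dots>, p (n + 3)\<close> are in general position if their projections to both factors are in
  linearly general position.
\<close>

definition general_position :: "nat \<Rightarrow> (nat \<Rightarrow> 'a::field point) \<Rightarrow> bool"
  where "general_position n p \<longleftrightarrow>
           (\<forall>i\<in>{1..n + 3}. p i \<in> PP n) \<and>
           (\<forall>is. distinct is \<and> set is \<subseteq> {1..n + 3} \<and> length is = n + 1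
                  \<longrightarrow> lin_indep (map (fst \<circ> p) is)) \<and>
           (\<forall>is. distinct is \<and> set is \<subseteq> {1..n + 3} \<and> length is = n + 2
                  \<longrightarrow> lin_indep (map (snd \<circ> p) is))"

definition BL :: "'a::field point list \<Rightarrow> 'a point set"
  where "BL zs = (fv.span (fst ` set zs) - {0}) \<times> (fv.span (snd ` set zs) - {0})"

definition BJ :: "nat \<Rightarrow> 'a::field point set list \<Rightarrow> 'a point set"
  where "BJ n Xs = zariski_closure n
           (\<Union>zs \<in> {zs. list_all2 (\<in>) zs Xs \<and> general_points zs}. BL zs)"

definition BS :: "nat \<Rightarrow> nat \<Rightarrow> 'a::field point set \<Rightarrow> 'a point set"
  where "BS n k C = BJ n (replicate k C)"


section \<open>Rational curves\<close>

text \<open>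
  Value at \<open>(s, t)\<close> of a vector of \<open>N + 1\<close> binary forms of degree \<open>d\<close>; the \<open>i\<close>-th form has the
  coefficients \<open>f i 0, \<dots>, f i d\<close>.
\<close>

definition bin_forms :: "nat \<Rightarrow> nat \<Rightarrow> (nat \<Rightarrow> nat \<Rightarrow> 'a::field) \<Rightarrow> 'a \<times> 'a \<Rightarrow> 'a vec"
  where "bin_forms N d f q =
           (\<lambda>i. if i \<le> N then (\<Sum>j\<le>d. f i j * fst q ^ j * snd q ^ (d - j)) else 0)"

definition same_P1 :: "'a::field \<times> 'a \<Rightarrow> 'a \<times> 'a \<Rightarrow> bool"
  where "same_P1 q r \<longleftrightarrow> fst q * snd r = fst r * snd q"

text \<open>
  \<open>C\<close> is the image of a morphism \<open>\<phi>\<close> from the projective line to the product that is injective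
  outside a finite set \<open>T\<close>; in characteristic zero this means that \<open>\<phi>\<close> is the normalization of \<open>C\<close>.
  The intersection number of \<open>C\<close> with \<open>H\<^sub>j\<close> is then the degree of the pullback of \<open>H\<^sub>j\<close> under
  \<open>\<phi>\<close>, which is the degree of the forms without common zero that define \<open>\<phi>\<close>.
\<close>

definition rational_curve :: "nat \<Rightarrow> nat \<Rightarrow> nat \<Rightarrow> 'a::field point set \<Rightarrow> bool"
  where "rational_curve n a b C \<longleftrightarrow>
           (\<exists>f g. let \<phi> = (\<lambda>q. (bin_forms n a f q, bin_forms (n + 1) b g q)) in
              (\<forall>q. q \<noteq> (0, 0) \<longrightarrow> \<phi> q \<in> PP n) \<and>
              (\<exists>T. finite T \<and> (0, 0) \<notin> T \<and>
                 (\<forall>q r. q \<noteq> (0, 0) \<and> r \<noteq> (0, 0) \<and> (\<forall>t\<in>T. \<not> same_P1 q t) \<and>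
                        same_point (\<phi> q) (\<phi> r) \<longrightarrow> same_P1 q r)) \<and>
              C = {z. \<exists>q. q \<noteq> (0, 0) \<and> same_point z (\<phi> q)})"

definition distinguished_curve :: "nat \<Rightarrow> (nat \<Rightarrow> 'a::field point) \<Rightarrow> 'a point set \<Rightarrow> bool"
  where "distinguished_curve n p C \<longleftrightarrow>
           rational_curve n n (n + 1) C \<and> (\<forall>i\<in>{1..n + 3}. p i \<in> C)"


section \<open>The blow-up and its divisors\<close>

text \<open>
  A point of the blow-up \<open>X\<close> at \<open>p 1, \<dots>, p (n + 3)\<close> is a point of the product different from
  all \<open>p i\<close>, or a pair of an index \<open>i\<close> and a tangent direction at \<open>p i = (a, b)\<close>.  The tangent space
  at \<open>p i\<close> is the quotient of \<open>coord_space n \<times> coord_space (n + 1)\<close> by the product of the lines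
  spanned by \<open>a\<close> and \<open>b\<close>, and \<open>Exc i v\<close> is the direction represented by \<open>v\<close>.
\<close>

datatype 'a bpoint = Off "'a point" | Exc nat "'a point"

definition blowup :: "nat \<Rightarrow> (nat \<Rightarrow> 'a::field point) \<Rightarrow> 'a bpoint set"
  where "blowup n p =
           {Off z | z. z \<in> PP n \<and> (\<forall>i\<in>{1..n + 3}. \<not> same_point z (p i))} \<union>
           {Exc i v | i v. i \<in> {1..n + 3} \<and> v \<in> coord_space n \<times> coord_space (n + 1) \<and>
              v \<notin> fv.span {fst (p i)} \<times> fv.span {snd (p i)}}"

text \<open>
  Near the exceptional divisor over \<open>(a, b)\<close> the blow-up is covered by the map
  \<open>(s, u, w) \<mapsto> ([a + s u], [b + s w])\<close>, which lifts to a smooth map to \<open>X\<close> for \<open>s\<close> near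
  \<open>0\<close> and \<open>(u, w)\<close> nonzero in the tangent space.  It sends \<open>(0, u, w)\<close> to the direction of \<open>(u, w)\<close>,
  and the pullback of the exceptional divisor is \<open>s = 0\<close>.  Orders of vanishing are unchanged by this
  smooth map, just as they are by the map from coordinate vectors to points of the product.
  In \<open>exc_chart\<close> the variable \<open>None\<close> is \<open>s\<close> and the variables \<open>Some _\<close> are the coordinates of \<open>(u, w)\<close>.
\<close>

definition exc_chart :: "'a::field point \<Rightarrow> (nat + nat, 'a) mpoly \<Rightarrow> ((nat + nat) option, 'a) mpoly"
  where "exc_chart z F = msubst Const (\<lambda>v. Const (coords z v) + Var None * Var (Some v)) F"

text \<open>
  \<open>(F, c)\<close> stands for the divisor \<open>\<pi>\<^sup>* (F = 0) + (\<Sum>i. c i * E\<^sub>i)\<close> on \<open>X\<close>, where \<open>\<pi>\<close> is the blow-down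
  map and \<open>F\<close> is a nonzero bihomogeneous form.  Its local equation is \<open>F\<close> off the exceptional
  divisors and \<open>s ^ c i * F (a + s u, b + s w)\<close> near \<open>E\<^sub>i\<close>, and it is effective iff the latter are
  regular.  Every effective divisor on \<open>X\<close> has this form: it is the strict transform of a
  hypersurface \<open>F = 0\<close> plus a nonnegative combination of the \<open>E\<^sub>i\<close>.
\<close>

type_synonym 'a bdivisor = "(nat + nat, 'a) mpoly \<times> (nat \<Rightarrow> int)"

definition effective :: "nat \<Rightarrow> (nat \<Rightarrow> 'a::field point) \<Rightarrow> 'a bdivisor \<Rightarrow> bool"
  where "effective n p \<Delta> \<longleftrightarrow> (case \<Delta> of (F, c) \<Rightarrow>
           F \<noteq> 0 \<and> (\<exists>d1 d2. bihomogeneous n d1 d2 F) \<and>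
           (\<forall>i\<in>{1..n + 3}. Var None ^ nat (- c i) dvd Var None ^ nat (c i) * exc_chart (p i) F))"

text \<open>
  The multiplicity at a point is the order of the local equation; note that \<open>s\<close> has order \<open>1\<close> at
  \<open>(0, u, w)\<close>.
\<close>

fun mult_at :: "(nat \<Rightarrow> 'a::field point) \<Rightarrow> 'a bdivisor \<Rightarrow> 'a bpoint \<Rightarrow> int"
  where
    "mult_at p (F, c) (Off z) = int (order_at (coords z) F)"
  | "mult_at p (F, c) (Exc i v) =
       c i + int (order_at (case_option 0 (coords v)) (exc_chart (p i) F))"

definition supp :: "nat \<Rightarrow> (nat \<Rightarrow> 'a::field point) \<Rightarrow> 'a bdivisor \<Rightarrow> 'a bpoint set"
  where "supp n p \<Delta> = {\<xi> \<in> blowup n p. mult_at p \<Delta> \<xi> \<ge> 1}"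

text \<open>
  As \<open>X\<close> is projective, the closed subsets of \<open>X\<close> are the intersections of supports of effective
  divisors.
\<close>

definition strict_transform :: "nat \<Rightarrow> (nat \<Rightarrow> 'a::field point) \<Rightarrow> 'a point set \<Rightarrow> 'a bpoint set"
  where "strict_transform n p V =
           {\<xi> \<in> blowup n p. \<forall>\<Delta>. effective n p \<Delta> \<and> Off ` V \<inter> blowup n p \<subseteq> supp n p \<Delta> \<longrightarrow> \<xi> \<in> supp n p \<Delta>}"

text \<open>
  The linear system of \<open>d1 * H\<^sub>1 + d2 * H\<^sub>2 - (\<Sum>i. m i * E\<^sub>i)\<close>: the pullback of a hypersurface of
  bidegree \<open>(d1, d2)\<close> is linearly equivalent to \<open>d1 * H\<^sub>1 + d2 * H\<^sub>2\<close>, and \<open>H\<^sub>1, H\<^sub>2, E\<^sub>1, \<dots>\<close>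
  is a basis of the Picard group.
\<close>

definition linear_system ::
    "nat \<Rightarrow> (nat \<Rightarrow> 'a::field point) \<Rightarrow> int \<Rightarrow> int \<Rightarrow> (nat \<Rightarrow> int) \<Rightarrow> 'a bdivisor set"
  where "linear_system n p d1 d2 m =
           {(F, c). effective n p (F, c) \<and> bihomogeneous n d1 d2 F \<and>
              (\<forall>i\<in>{1..n + 3}. c i = - m i)}"

text \<open>
  Multiplicity at least \<open>\<mu>\<close> at a general point of an irreducible closed subset \<open>Y\<close>, that is,
  outside the support of some effective divisor \<open>B\<close> that does not contain \<open>Y\<close>.
\<close>

definition mult_along_ge ::
    "nat \<Rightarrow> (nat \<Rightarrow> 'a::field point) \<Rightarrow> 'a bdivisor \<Rightarrow> 'a bpoint set \<Rightarrow> int \<Rightarrow> bool"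
  where "mult_along_ge n p \<Delta> Y \<mu> \<longleftrightarrow>
           (\<exists>B. effective n p B \<and> \<not> Y \<subseteq> supp n p B \<and>
              (\<forall>\<xi>\<in>Y - supp n p B. mult_at p \<Delta> \<xi> \<ge> \<mu>))"

definition in_base_locus_at_least ::
    "nat \<Rightarrow> (nat \<Rightarrow> 'a::field point) \<Rightarrow> int \<Rightarrow> int \<Rightarrow> (nat \<Rightarrow> int) \<Rightarrow> 'a bpoint set \<Rightarrow> int \<Rightarrow> bool"
  where "in_base_locus_at_least n p d1 d2 m Y \<mu> \<longleftrightarrow>
           (\<forall>\<Delta>\<in>linear_system n p d1 d2 m. mult_along_ge n p \<Delta> Y \<mu>)"

end

theory Submission
  imports Defs
begin

text \<open>
Let \<open>F\<close> be a form of bidegree \<open>(d1, d2)\<close> that vanishes to order at least \<open>m i\<close> at every \<open>p i\<close>, and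
let \<open>F\<^sub>r(x; v)\<close> be the coefficient of \<open>\<epsilon>^r\<close> in \<open>F(x + \<epsilon> v)\<close>.  Then \<open>F\<close> vanishes to order at least
\<open>m\<close> at \<open>x\<close> iff \<open>F\<^sub>r(x; v) = 0\<close> for all directions \<open>v\<close> and all \<open>r < m\<close> (\<open>ord_geI\<close>, \<open>taylorK_eq_0\<close>).

The order along the curve \<open>C\<close> is at least \<open>M = (\<Sum>i. m i) - n d1 - (n + 1) d2\<close>.  In geometric terms,
\<open>- M\<close> is the intersection number of the divisor with the strict transform of \<open>C\<close>, whose normal
bundle is a sum of \<open>2 n\<close> copies of \<open>O(-1)\<close>.  If \<open>F\<close> has order at least \<open>r\<close> along \<open>C\<close>, then its
leading term of degree \<open>r\<close> is a section of a sum of copies of \<open>O(r - M)\<close>, which vanishes for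
\<open>r < M\<close>.  The lemma \<open>curve_leading_term_vanishes\<close> replaces the bundle by explicit polynomials.
With \<open>\<phi>\<close> a parametrization of \<open>C\<close>, \<open>\<phi>(t\<^sub>j) = (a\<^sub>j, b\<^sub>j)\<close> representing \<open>p j\<close>, \<open>Q = \<Prod>\<^sub>j (t - t\<^sub>j)\<close> and
\<open>R\<^sub>j = Q / (t - t\<^sub>j)\<close>, it uses the directions
\<open>V = \<Sum>\<^sub>j (\<lambda>\<^sub>j R\<^sub>j\<^sup>2 (a\<^sub>j, b\<^sub>j) + \<kappa>\<^sub>j Q R\<^sub>j (0, b\<^sub>j))\<close>.
They fill the whole space at every parameter other than the \<open>t\<^sub>j\<close>, because the \<open>a\<^sub>j\<close> and the \<open>b\<^sub>j\<close>
span.  Since \<open>F\<^sub>r(\<phi>(t); v)\<close> depends on \<open>v\<close> only modulo the tangent space of the cone over \<open>C\<close>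
(\<open>taylor_tangent_cone\<close>), and \<open>V\<close> agrees with a multiple of \<open>(t - t\<^sub>j)\<^sup>2\<close> modulo that space, the
polynomial \<open>F\<^sub>r(\<phi>; V)\<close> vanishes at \<open>t\<^sub>j\<close> to order at least \<open>2 r + (m j - r)\<close>.  Its degree is at most
\<open>n d1 + (n + 1) d2 + (n + 4) r\<close>, so the \<open>n + 3\<close> zeros force it to be \<open>0\<close> as soon as \<open>r < M\<close>.

If \<open>F\<close> has orders at least \<open>a\<close> and \<open>b\<close> at \<open>x\<close> and \<open>y\<close>, then it has order at least
\<open>a + b - (d1 + d2)\<close> on the bilinear span of \<open>x\<close> and \<open>y\<close> (\<open>ord_ge_join\<close>): the span is covered by curves
of bidegree \<open>(1, 1)\<close> through \<open>x\<close> and \<open>y\<close>, on which \<open>F\<close> has degree \<open>d1 + d2\<close>, and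
passing to a derivative of order \<open>q\<close> lowers each of \<open>a\<close>, \<open>b\<close> and this degree by \<open>q\<close>.  Iterating this for \<open>k\<close>
points of \<open>C\<close> and for \<open>p i\<^sub>1, \<dots>, p i\<^sub>l\<close> bounds the order from below by
\<open>k M + (\<Sum>j. m i\<^sub>j) - (k + l - 1) (d1 + d2)\<close>, which is the number in the theorem.

Finally, the condition that \<open>F\<close> has order at least \<open>m\<close> is given by the vanishing of partial
derivatives, which are bihomogeneous again; so it passes to the Zariski closures in the definition
of the joins and to the points of the strict transform off the exceptional divisors
(\<open>ord_ge_of_vanishing\<close>).
\<close>

section \<open>Substitution into polynomials\<close>

abbreviation "keys \<equiv> Poly_Mapping.keys"
abbreviation "lookup \<equiv> Poly_Mapping.lookup"
abbreviation "single \<equiv> Poly_Mapping.single"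

definition is_ring_hom :: "('a::comm_ring_1 \<Rightarrow> 'b::comm_ring_1) \<Rightarrow> bool"
  where "is_ring_hom h \<longleftrightarrow> h 0 = 0 \<and> h 1 = 1 \<and> (\<forall>a b. h (a + b) = h a + h b) \<and> (\<forall>a b. h (a * b) = h a * h b)"

lemma is_ring_homD:
  assumes "is_ring_hom h"
  shows "h 0 = 0" "h 1 = 1" "h (a + b) = h a + h b" "h (a * b) = h a * h b"
  using assms by (simp_all add: is_ring_hom_def)

lemma is_ring_hom_sum: "is_ring_hom h \<Longrightarrow> h (sum f A) = (\<Sum>x\<in>A. h (f x))"
  by (induction A rule: infinite_finite_induct) (simp_all add: is_ring_homD)

lemma is_ring_hom_prod: "is_ring_hom h \<Longrightarrow> h (prod f A) = (\<Prod>x\<in>A. h (f x))"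
  by (induction A rule: infinite_finite_induct) (simp_all add: is_ring_homD)

lemma is_ring_hom_power: "is_ring_hom h \<Longrightarrow> h (x ^ k) = h x ^ k"
  by (induction k) (simp_all add: is_ring_homD)

lemma is_ring_hom_id: "is_ring_hom id" by (simp add: is_ring_hom_def)

lemma is_ring_hom_const_poly: "is_ring_hom h \<Longrightarrow> is_ring_hom (\<lambda>c. [:h c:])"
  by (simp add: is_ring_hom_def one_pCons)

lemma is_ring_hom_Const: "is_ring_hom Const"
  by (simp add: is_ring_hom_def Const_def single_add mult_single)

lemma is_ring_hom_poly: "is_ring_hom (\<lambda>p. poly p x)"
  by (simp add: is_ring_hom_def)

lemma is_ring_hom_pcompose: "is_ring_hom (\<lambda>p. pcompose p q)"
  by (simp add: is_ring_hom_def pcompose_add pcompose_mult pcompose_1)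

lemma is_ring_hom_map_poly:
  assumes h: "is_ring_hom h"
  shows "is_ring_hom (map_poly h)"
  unfolding is_ring_hom_def
proof (intro conjI allI)
  show "map_poly h 0 = 0" by simp
  show "map_poly h 1 = 1" using is_ring_homD[OF h] by (simp add: one_pCons map_poly_pCons)
  show "map_poly h (a + b) = map_poly h a + map_poly h b" for a b
    using is_ring_homD[OF h] by (simp add: poly_eq_iff coeff_map_poly)
  show "map_poly h (a * b) = map_poly h a * map_poly h b" for a b
    using is_ring_homD[OF h] by (simp add: poly_eq_iff coeff_map_poly coeff_mult is_ring_hom_sum[OF h])
qed

definition monomial_value :: "('v \<Rightarrow> 'b::comm_ring_1) \<Rightarrow> ('v \<Rightarrow>\<^sub>0 nat) \<Rightarrow> 'b"
  where "monomial_value \<sigma> \<mu> = (\<Prod>v\<in>keys \<mu>. \<sigma> v ^ lookup \<mu> v)"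

lemma monomial_value_superset:
  assumes "finite A" "keys \<mu> \<subseteq> A"
  shows "monomial_value \<sigma> \<mu> = (\<Prod>v\<in>A. \<sigma> v ^ lookup \<mu> v)"
  unfolding monomial_value_def using assms by (intro prod.mono_neutral_left) (auto simp: in_keys_iff)

lemma monomial_value_0 [simp]: "monomial_value \<sigma> 0 = 1"
  by (simp add: monomial_value_def)

lemma monomial_value_add: "monomial_value \<sigma> (\<mu> + \<nu>) = monomial_value \<sigma> \<mu> * monomial_value \<sigma> \<nu>"
proof -
  let ?A = "keys \<mu> \<union> keys \<nu>"
  have "monomial_value \<sigma> (\<mu> + \<nu>) = (\<Prod>v\<in>?A. \<sigma> v ^ lookup (\<mu> + \<nu>) v)"
    by (intro monomial_value_superset) (auto simp: in_keys_iff lookup_add)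
  moreover have "monomial_value \<sigma> \<mu> = (\<Prod>v\<in>?A. \<sigma> v ^ lookup \<mu> v)" by (intro monomial_value_superset) auto
  moreover have "monomial_value \<sigma> \<nu> = (\<Prod>v\<in>?A. \<sigma> v ^ lookup \<nu> v)" by (intro monomial_value_superset) auto
  ultimately show ?thesis by (simp add: lookup_add power_add prod.distrib)
qed

lemma monomial_value_single: "monomial_value \<sigma> (single v k) = \<sigma> v ^ k"
  by (cases "k = 0") (simp_all add: monomial_value_def)

lemma msubst_altdef: "msubst h \<sigma> F = (\<Sum>\<mu>\<in>keys F. h (lookup F \<mu>) * monomial_value \<sigma> \<mu>)"
  by (simp add: msubst_def monomial_value_def)

lemma msubst_superset:
  assumes "finite A" "keys F \<subseteq> A" "h 0 = 0"
  shows "msubst h \<sigma> F = (\<Sum>\<mu>\<in>A. h (lookup F \<mu>) * monomial_value \<sigma> \<mu>)"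
  unfolding msubst_altdef using assms
  by (intro sum.mono_neutral_left) (auto simp: in_keys_iff)

lemma msubst_0 [simp]: "msubst h \<sigma> 0 = 0"
  by (simp add: msubst_altdef)

lemma msubst_single: "h 0 = 0 \<Longrightarrow> msubst h \<sigma> (single \<mu> c) = h c * monomial_value \<sigma> \<mu>"
  by (cases "c = 0") (simp_all add: msubst_altdef)

lemma msubst_add:
  assumes "is_ring_hom h"
  shows "msubst h \<sigma> (F + G) = msubst h \<sigma> F + msubst h \<sigma> G"
proof -
  let ?A = "keys F \<union> keys G"
  note h = is_ring_homD[OF assms]
  have "msubst h \<sigma> (F + G) = (\<Sum>\<mu>\<in>?A. h (lookup (F + G) \<mu>) * monomial_value \<sigma> \<mu>)"
    by (intro msubst_superset) (auto simp: h in_keys_iff lookup_add)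
  moreover have "msubst h \<sigma> F = (\<Sum>\<mu>\<in>?A. h (lookup F \<mu>) * monomial_value \<sigma> \<mu>)"
    by (intro msubst_superset) (auto simp: h)
  moreover have "msubst h \<sigma> G = (\<Sum>\<mu>\<in>?A. h (lookup G \<mu>) * monomial_value \<sigma> \<mu>)"
    by (intro msubst_superset) (auto simp: h)
  ultimately show ?thesis by (simp add: lookup_add h sum.distrib algebra_simps)
qed

lemma mpoly_induct [case_names zero single add]:
  fixes F :: "('v, 'a::comm_ring_1) mpoly"
  assumes "P 0" "\<And>\<mu> c. P (single \<mu> c)" "\<And>F G. P F \<Longrightarrow> P G \<Longrightarrow> P (F + G)"
  shows "P F"
proof (induction F rule: Poly_Mapping.update_induct)
  case const then show ?case using assms by simp
next
  case (update f a b)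
  have "Poly_Mapping.update a b f = f + single a b"
    using update(1) by (intro poly_mapping_eqI) (auto simp: lookup_add lookup_update lookup_single when_def in_keys_iff)
  then show ?case using assms update by simp
qed

lemma msubst_mult:
  assumes h: "is_ring_hom h"
  shows "msubst h \<sigma> (F * G) = msubst h \<sigma> F * msubst h \<sigma> G"
proof (induction F rule: mpoly_induct)
  case (single \<mu> c)
  show ?case
  proof (induction G rule: mpoly_induct)
    case (single \<nu> e)
    show ?case using is_ring_homD[OF h] by (simp add: mult_single msubst_single monomial_value_add)
  qed (simp_all add: msubst_add[OF h] algebra_simps)
qed (simp_all add: msubst_add[OF h] algebra_simps)

lemma is_ring_hom_msubst:
  assumes h: "is_ring_hom h"
  shows "is_ring_hom (msubst h \<sigma>)"
  unfolding is_ring_hom_def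
proof (intro conjI allI)
  have "msubst h \<sigma> (single 0 1) = 1" using is_ring_homD[OF h] by (subst msubst_single) auto
  then show "msubst h \<sigma> 1 = 1" by simp
qed (simp_all add: msubst_add[OF h] msubst_mult[OF h])

lemma msubst_Const: "is_ring_hom h \<Longrightarrow> msubst h \<sigma> (Const c) = h c"
  unfolding Const_def using is_ring_homD[of h] by (subst msubst_single) auto

lemma msubst_Var: "is_ring_hom h \<Longrightarrow> msubst h \<sigma> (Var v) = \<sigma> v"
  unfolding Var_def using is_ring_homD[of h] by (subst msubst_single) (auto simp: monomial_value_single)

lemma hom_monomial_value: "is_ring_hom g \<Longrightarrow> g (monomial_value \<sigma> \<mu>) = monomial_value (\<lambda>v. g (\<sigma> v)) \<mu>"
  by (simp add: monomial_value_def is_ring_hom_prod is_ring_hom_power)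

lemma hom_msubst:
  assumes g: "is_ring_hom g"
  shows "g (msubst h \<sigma> F) = msubst (\<lambda>c. g (h c)) (\<lambda>v. g (\<sigma> v)) F"
  by (simp add: msubst_altdef is_ring_hom_sum[OF g] is_ring_homD[OF g] hom_monomial_value[OF g])

lemma msubst_msubst:
  assumes h: "is_ring_hom h"
  shows "msubst h \<tau> (msubst Const \<sigma> F) = msubst h (\<lambda>v. msubst h \<tau> (\<sigma> v)) F"
  using hom_msubst[OF is_ring_hom_msubst[OF h], of \<tau> Const \<sigma> F] by (simp add: msubst_Const[OF h])

lemma monomial_value_Var: "monomial_value Var \<mu> = single \<mu> (1::'a::comm_ring_1)"
proof -
  have pow: "(Var v :: ('v, 'a) mpoly) ^ k = single (single v k) 1" for v :: 'v and k
  proof (induction k)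
    case (Suc k)
    have "single v (Suc 0) + single v k = single v (Suc k)"
      using single_add[of v 1 k] by simp
    with Suc show ?case by (simp add: Var_def mult_single del: single_add)
  qed simp
  have "(\<Prod>v\<in>A. Var v ^ lookup \<mu> v) = single (\<Sum>v\<in>A. single v (lookup \<mu> v)) (1::'a)" if "finite A" for A
    using that by (induction A) (simp_all add: pow mult_single)
  moreover have "(\<Sum>v\<in>keys \<mu>. single v (lookup \<mu> v)) = \<mu>"
    by (intro poly_mapping_eqI) (auto simp: lookup_sum lookup_single when_def in_keys_iff)
  ultimately show ?thesis by (simp add: monomial_value_def)
qed

lemma msubst_Const_Var: "msubst Const Var F = (F :: ('v, 'a::comm_ring_1) mpoly)"
  by (induction F rule: mpoly_induct)
     (simp_all add: msubst_add[OF is_ring_hom_Const] msubst_single is_ring_homD[OF is_ring_hom_Const] monomial_value_Var, simp add: Const_def mult_single)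

lemma mpoly_ring_induct [case_names Const Var add mult]:
  fixes F :: "('v, 'a::comm_ring_1) mpoly"
  assumes "\<And>c. P (Const c)" "\<And>v. P (Var v)"
    and "\<And>F G. P F \<Longrightarrow> P G \<Longrightarrow> P (F + G)" and m: "\<And>F G. P F \<Longrightarrow> P G \<Longrightarrow> P (F * G)"
  shows "P F"
proof (induction F rule: mpoly_induct)
  case zero show ?case using assms(1)[of 0] by (simp add: Const_def)
next
  case (single \<mu> c)
  have 1: "P 1" using assms(1)[of 1] by (simp add: Const_def)
  have pow: "P (x ^ k)" if "P x" for x k using that 1 by (induction k) (auto intro: m)
  have "P (\<Prod>v\<in>A. Var v ^ lookup \<mu> v)" if "finite A" for A
    using that by (induction A) (auto intro!: m pow assms(2) simp: 1)
  then have "P (monomial_value Var \<mu>)" by (simp add: monomial_value_def)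
  then have "P (Const c * monomial_value Var \<mu>)" by (intro m assms)
  then show ?case by (simp add: monomial_value_Var Const_def mult_single)
qed (rule assms)

lemma monomial_value_filtered:
  fixes P :: "nat \<Rightarrow> 'b::comm_ring_1 \<Rightarrow> bool"
  assumes "P 0 1" and m: "\<And>a b x y. P a x \<Longrightarrow> P b y \<Longrightarrow> P (a + b) (x * y)"
    and v: "\<And>v. v \<in> keys \<mu> \<Longrightarrow> P (\<omega> v) (\<sigma> v)"
  shows "P (\<Sum>v\<in>keys \<mu>. \<omega> v * lookup \<mu> v) (monomial_value \<sigma> \<mu>)"
proof -
  have pow: "P (a * k) (x ^ k)" if "P a x" for a x k
    using that assms(1) by (induction k) (auto dest: m)
  have "P (\<Sum>v\<in>A. \<omega> v * lookup \<mu> v) (\<Prod>v\<in>A. \<sigma> v ^ lookup \<mu> v)" if "finite A" "A \<subseteq> keys \<mu>" for A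
    using that by (induction A) (auto intro!: m pow v simp: assms(1))
  then show ?thesis by (simp add: monomial_value_def)
qed

text \<open>
Here \<open>P w\<close> is the piece of index \<open>w\<close> of a multiplicative filtration of the target ring.  The last
hypothesis compares pieces, so that increasing filtrations (by degree) and decreasing ones (by order
of vanishing) are both covered.
\<close>

lemma msubst_filtered:
  fixes P :: "nat \<Rightarrow> 'b::comm_ring_1 \<Rightarrow> bool"
  assumes "P W 0" and add: "\<And>x y. P W x \<Longrightarrow> P W y \<Longrightarrow> P W (x + y)"
    and m: "\<And>a b x y. P a x \<Longrightarrow> P b y \<Longrightarrow> P (a + b) (x * y)"
    and "P 0 1" and c: "\<And>c. P 0 (h c)"
    and v: "\<And>\<mu> v. \<mu> \<in> keys F \<Longrightarrow> v \<in> keys \<mu> \<Longrightarrow> P (\<omega> v) (\<sigma> v)"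
    and W: "\<And>\<mu> x. \<mu> \<in> keys F \<Longrightarrow> P (\<Sum>v\<in>keys \<mu>. \<omega> v * lookup \<mu> v) x \<Longrightarrow> P W x"
  shows "P W (msubst h \<sigma> F)"
proof -
  have summand: "P W (h (lookup F \<mu>) * monomial_value \<sigma> \<mu>)" if "\<mu> \<in> keys F" for \<mu>
  proof -
    have "P (\<Sum>v\<in>keys \<mu>. \<omega> v * lookup \<mu> v) (monomial_value \<sigma> \<mu>)"
      by (rule monomial_value_filtered[where P = P]) (use that in \<open>simp_all add: m v assms(4)\<close>)
    from W[OF that m[OF c this, simplified]] show ?thesis .
  qed
  have "P W (\<Sum>\<mu>\<in>A. h (lookup F \<mu>) * monomial_value \<sigma> \<mu>)" if "finite A" "A \<subseteq> keys F" for A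
    using that by (induction A) (auto intro: add summand simp: assms(1))
  then show ?thesis by (simp add: msubst_altdef)
qed

section \<open>Taylor expansion and the order of vanishing\<close>

text \<open>
The restriction of \<open>F\<close> to the line through \<open>x\<close> with direction \<open>v\<close>, as a polynomial in the line
parameter.  The target ring is arbitrary because the same expansion is needed for constant and for
polynomial families of points and directions.
\<close>

definition on_line :: "('a::comm_ring_1 \<Rightarrow> 'b::comm_ring_1) \<Rightarrow> ('v, 'a) mpoly \<Rightarrow> ('v \<Rightarrow> 'b) \<Rightarrow> ('v \<Rightarrow> 'b) \<Rightarrow> 'b poly"
  where "on_line h F x v = msubst (\<lambda>c. [:h c:]) (\<lambda>i. [:x i, v i:]) F"

definition taylor :: "('a::comm_ring_1 \<Rightarrow> 'b::comm_ring_1) \<Rightarrow> ('v, 'a) mpoly \<Rightarrow> nat \<Rightarrow> ('v \<Rightarrow> 'b) \<Rightarrow> ('v \<Rightarrow> 'b) \<Rightarrow> 'b"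
  where "taylor h F r x v = coeff (on_line h F x v) r"

text \<open>
Points and directions over the coefficient ring itself, and families of them that depend polynomially
on one parameter.
\<close>

abbreviation "taylorK \<equiv> taylor (\<lambda>c. c)"
abbreviation "taylorP \<equiv> taylor (\<lambda>c. [:c:])"

lemma is_ring_hom_ident: "is_ring_hom (\<lambda>c. c)"
  by (simp add: is_ring_hom_def)

lemma is_ring_hom_pconst: "is_ring_hom (\<lambda>c. [:c:])"
  using is_ring_hom_const_poly[OF is_ring_hom_ident] .

lemma hom_taylor:
  assumes g: "is_ring_hom g"
  shows "g (taylor h F r x v) = taylor (\<lambda>c. g (h c)) F r (\<lambda>i. g (x i)) (\<lambda>i. g (v i))"
proof -
  have "map_poly g (on_line h F x v) = on_line (\<lambda>c. g (h c)) F (\<lambda>i. g (x i)) (\<lambda>i. g (v i))"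
    unfolding on_line_def using is_ring_homD(1)[OF g]
    by (simp add: hom_msubst[OF is_ring_hom_map_poly[OF g]] map_poly_pCons)
  then show ?thesis
    by (metis taylor_def coeff_map_poly is_ring_homD(1)[OF g])
qed

lemma poly_taylorP: "poly (taylorP F r X V) t = taylorK F r (\<lambda>i. poly (X i) t) (\<lambda>i. poly (V i) t)"
  by (subst hom_taylor[OF is_ring_hom_poly[of t]]) simp

lemma poly_on_line:
  assumes "is_ring_hom h"
  shows "poly (on_line h F x v) e = msubst h (\<lambda>i. x i + e * v i) F"
  unfolding on_line_def by (subst hom_msubst[OF is_ring_hom_poly]) simp

lemma taylor_scale:
  assumes "is_ring_hom h"
  shows "taylor h F r x (\<lambda>i. s * v i) = s ^ r * taylor h F r x v"
proof -
  have "pcompose (on_line h F x v) [:0, s:] = on_line h F x (\<lambda>i. s * v i)"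
    unfolding on_line_def by (subst hom_msubst[OF is_ring_hom_pcompose]) (simp add: pcompose_pCons mult.commute)
  then show ?thesis by (metis taylor_def coeff_pcompose_linear)
qed

definition shift :: "('v \<Rightarrow> 'a::comm_ring_1) \<Rightarrow> ('v, 'a) mpoly \<Rightarrow> ('v, 'a) mpoly"
  where "shift x F = msubst Const (\<lambda>v. Const (x v) + Var v) F"

lemma msubst_shift:
  assumes "is_ring_hom h"
  shows "msubst h z (shift x F) = msubst h (\<lambda>i. h (x i) + z i) F"
  unfolding shift_def msubst_msubst[OF assms]
  using assms by (simp add: msubst_add msubst_Const msubst_Var)

lemma shift_shift: "shift y (shift x F) = shift (\<lambda>i. x i + y i) F"
  unfolding shift_def[of y] msubst_shift[OF is_ring_hom_Const] unfolding shift_def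
  by (simp add: Const_def single_add add.assoc)

lemma shift_0: "shift (\<lambda>i. 0) F = F"
  using msubst_Const_Var[of F] by (simp add: shift_def is_ring_homD(1)[OF is_ring_hom_Const])

lemma shift_eq_0_iff [simp]: "shift x F = 0 \<longleftrightarrow> F = 0"
proof
  assume "shift x F = 0"
  then have "shift (\<lambda>i. - x i) (shift x F) = 0" by (simp add: shift_def)
  then show "F = 0" by (simp add: shift_shift shift_0)
qed (simp add: shift_def)

text \<open>
The bound \<open>m\<close> is an integer and \<open>F\<close> may be zero: negative bounds arise in the estimates for joins, and
partial derivatives of a nonzero form can vanish.
\<close>

definition ord_ge :: "('v \<Rightarrow> 'a::comm_ring_1) \<Rightarrow> ('v, 'a) mpoly \<Rightarrow> int \<Rightarrow> bool"
  where "ord_ge x F m \<longleftrightarrow> (\<forall>\<beta>\<in>keys (shift x F). m \<le> int (mdegree \<beta>))"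

lemma ord_ge_iff_order_at: 
  assumes "F \<noteq> 0"
  shows "ord_ge x F m \<longleftrightarrow> m \<le> int (order_at x F)"
proof -
  have ne: "keys (shift x F) \<noteq> {}" using assms by simp
  have "m \<le> int (order_at x F) \<longleftrightarrow> nat m \<le> Min (mdegree ` keys (shift x F))"
    by (auto simp: order_at_def shift_def nat_le_iff)
  also have "\<dots> \<longleftrightarrow> ord_ge x F m"
    using ne by (subst Min_ge_iff) (auto simp: ord_ge_def)
  finally show ?thesis by simp
qed

text \<open>
If \<open>F\<close> has order at least \<open>m\<close> at \<open>x = X(c)\<close>, then its derivatives of order \<open>r\<close> have order at least
\<open>m - r\<close> there.  In the Taylor expansion of \<open>F\<close> at \<open>x\<close> every variable is replaced by an element of
the ideal generated by \<open>t - c\<close> and \<open>\<epsilon>\<close>, so the result lies in the \<open>m\<close>-th power of this ideal.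
\<close>

lemma dvd_taylorP:
  fixes X V :: "'v \<Rightarrow> 'a::field poly"
  assumes F: "ord_ge x F m" and X: "\<And>i. poly (X i) c = x i"
  shows "[:-c, 1:] ^ nat (m - int r) dvd taylorP F r X V"
proof -
  define s where "s = [:-c, 1:]"
  have "\<exists>X'. \<forall>i. X i = [:x i:] + s * X' i"
  proof -
    have "s dvd X i - [:x i:]" for i
      unfolding s_def using X[of i] by (subst poly_eq_0_iff_dvd[symmetric]) simp
    then show ?thesis by (intro choice) (auto simp: dvd_def algebra_simps)
  qed
  then obtain X' where X': "\<And>i. X i = [:x i:] + s * X' i" by blast
  \<comment> \<open>membership in the \<open>w\<close>-th power of the ideal generated by \<open>s\<close> and \<open>\<epsilon>\<close>\<close>
  define P where "P w p \<longleftrightarrow> (\<forall>q. s ^ (w - q) dvd coeff p q)" for w and p :: "'a poly poly"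
  have "on_line (\<lambda>c. [:c:]) F X V = msubst (\<lambda>c. [:[:c:]:]) (\<lambda>i. [:s * X' i, V i:]) (shift x F)"
    unfolding msubst_shift[OF is_ring_hom_const_poly[OF is_ring_hom_pconst]] on_line_def by (simp add: X')
  moreover have "P (nat m) (msubst (\<lambda>c. [:[:c:]:]) (\<lambda>i. [:s * X' i, V i:]) (shift x F))"
  proof (rule msubst_filtered[where \<omega> = "\<lambda>_. 1"])
    show "P (a + b) (p * q)" if p: "P a p" and q: "P b q" for a b p q
      unfolding P_def
    proof
      fix k
      have "s ^ (a + b - k) dvd coeff p i * coeff q (k - i)" if "i \<le> k" for i
      proof -
        have "s ^ ((a - i) + (b - (k - i))) dvd coeff p i * coeff q (k - i)"
          using p q by (simp add: P_def power_add mult_dvd_mono)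
        moreover have "a + b - k \<le> (a - i) + (b - (k - i))" using that by simp
        ultimately show ?thesis by (rule dvd_trans[OF le_imp_power_dvd, rotated])
      qed
      then show "s ^ (a + b - k) dvd coeff (p * q) k"
        by (auto simp: coeff_mult intro!: dvd_sum)
    qed
    show "P 1 [:s * X' i, V i:]" for i
      unfolding P_def
    proof
      fix q show "s ^ (1 - q) dvd coeff [:s * X' i, V i:] q" by (cases q) auto
    qed
    show "P (nat m) p" if "\<mu> \<in> keys (shift x F)" "P (\<Sum>v\<in>keys \<mu>. 1 * lookup \<mu> v) p" for \<mu> p
    proof -
      have "m \<le> int (mdegree \<mu>)" using F that by (simp add: ord_ge_def)
      then have "nat m - q \<le> mdegree \<mu> - q" for q by linarith
      then show ?thesis
        using that(2) by (auto simp: P_def mdegree_def intro: dvd_trans[OF le_imp_power_dvd])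
    qed
  qed (auto simp: P_def)
  moreover have "nat m - r = nat (m - int r)" by linarith
  ultimately show ?thesis
    unfolding taylor_def s_def[symmetric] P_def by (auto dest: spec[of _ r])
qed

lemma taylorK_eq_0:
  fixes x :: "'v \<Rightarrow> 'a::field"
  assumes "ord_ge x F m" "int r < m"
  shows "taylorK F r x v = 0"
proof -
  have "[:-0, 1:] ^ nat (m - int r) dvd taylorP F r (\<lambda>i. [:x i:]) (\<lambda>i. [:v i:])"
    by (rule dvd_taylorP[OF assms(1)]) simp
  moreover have "nat (m - int r) \<noteq> 0" using assms by simp
  ultimately have "[:-0, 1:] dvd taylorP F r (\<lambda>i. [:x i:]) (\<lambda>i. [:v i:])"
    by (meson dvd_power dvd_trans gr0I)
  then have "poly (taylorP F r (\<lambda>i. [:x i:]) (\<lambda>i. [:v i:])) 0 = 0"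
    by (simp only: poly_eq_0_iff_dvd)
  then show ?thesis by (simp add: poly_taylorP)
qed

text \<open>
Kronecker substitution: replacing each variable \<open>v\<close> by \<open>t ^ w v\<close>, where the weights are powers of
\<open>B\<close>, keeps distinct monomials with exponents below \<open>B\<close> distinct.
\<close>

lemma separating_weights:
  assumes "finite V"
  shows "\<exists>w :: 'v \<Rightarrow> nat. \<forall>f g. (\<forall>v\<in>V. f v < B \<and> g v < B) \<and> (\<Sum>v\<in>V. w v * f v) = (\<Sum>v\<in>V. w v * g v)
           \<longrightarrow> (\<forall>v\<in>V. f v = g v)"
  using assms
proof (induction V)
  case (insert x V)
  then obtain w :: "'v \<Rightarrow> nat" where
    w: "\<And>f g. (\<forall>v\<in>V. f v < B \<and> g v < B) \<Longrightarrow> (\<Sum>v\<in>V. w v * f v) = (\<Sum>v\<in>V. w v * g v) \<Longrightarrow> (\<forall>v\<in>V. f v = g v)"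
    by blast
  define w' where "w' = (\<lambda>v. B * w v)(x := 1)"
  have w': "(\<Sum>v\<in>insert x V. w' v * f v) = f x + B * (\<Sum>v\<in>V. w v * f v)" for f
  proof -
    have "(\<Sum>v\<in>V. w' v * f v) = (\<Sum>v\<in>V. B * w v * f v)"
      using insert by (intro sum.cong) (auto simp: w'_def)
    then show ?thesis using insert by (simp add: w'_def sum_distrib_left mult.assoc)
  qed
  have "\<forall>v\<in>insert x V. f v = g v" if bd: "\<forall>v\<in>insert x V. f v < B \<and> g v < B"
    and eq: "(\<Sum>v\<in>insert x V. w' v * f v) = (\<Sum>v\<in>insert x V. w' v * g v)" for f g
  proof -
    let ?s = "\<lambda>f. \<Sum>v\<in>V. w v * f v"
    have e: "f x + B * ?s f = g x + B * ?s g" using eq by (simp add: w')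
    have "(f x + B * ?s f) mod B = f x" "(g x + B * ?s g) mod B = g x" using bd by simp_all
    then have 1: "f x = g x" using e by simp
    moreover have "B > 0" using bd by auto
    ultimately have "?s f = ?s g" using e by simp
    then show ?thesis using w[of f g] bd 1 by simp
  qed
  then show ?case by blast
qed simp

lemma poly_eq_0_of_cofinite_zeros:
  fixes p :: "'a::field_char_0 poly"
  assumes "finite T" "\<And>t. t \<notin> T \<Longrightarrow> poly p t = 0"
  shows "p = 0"
proof (rule ccontr)
  assume "p \<noteq> 0"
  then have "finite {t. poly p t = 0}" by (rule poly_roots_finite)
  then have "finite (T \<union> {t. poly p t = 0})" using assms by simp
  moreover have "T \<union> {t. poly p t = 0} = UNIV" using assms by auto
  ultimately show False using infinite_UNIV_char_0 by metis
qed

text \<open>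
A nonzero form over an infinite field does not vanish in all directions.  A Kronecker substitution
reduces this to polynomials in one variable.
\<close>

lemma ord_geI:
  fixes x :: "'v \<Rightarrow> 'a::field_char_0"
  assumes "\<And>r v. int r < m \<Longrightarrow> taylorK F r x v = 0"
  shows "ord_ge x F m"
  unfolding ord_ge_def
proof (rule ballI, rule ccontr)
  fix \<beta> assume \<beta>: "\<beta> \<in> keys (shift x F)" and "\<not> m \<le> int (mdegree \<beta>)"
  then have d: "int (mdegree \<beta>) < m" by simp
  define S where "S = shift x F"
  define V where "V = (\<Union>\<mu>\<in>keys S. keys \<mu>)"
  have fV: "finite V" by (simp add: V_def)
  define B where "B = Suc (Max (insert 0 ((\<lambda>(\<mu>, v). lookup \<mu> v) ` (keys S \<times> V))))"
  have B: "lookup \<mu> v < B" if "\<mu> \<in> keys S" "v \<in> V" for \<mu> v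
    unfolding B_def less_Suc_eq_le using fV that by (intro Max_ge) (auto intro!: image_eqI[of _ _ "(\<mu>, v)"])
  obtain w :: "'v \<Rightarrow> nat" where
    w: "\<And>f g. (\<forall>v\<in>V. f v < B \<and> g v < B) \<Longrightarrow> (\<Sum>v\<in>V. w v * f v) = (\<Sum>v\<in>V. w v * g v) \<Longrightarrow> (\<forall>v\<in>V. f v = g v)"
    using separating_weights[OF fV, of B] by blast
  let ?wt = "\<lambda>\<mu>. \<Sum>v\<in>V. w v * lookup \<mu> v"
  have inj: "\<mu> = \<beta>" if "\<mu> \<in> keys S" "?wt \<mu> = ?wt \<beta>" for \<mu>
  proof (rule poly_mapping_eqI)
    fix v
    show "lookup \<mu> v = lookup \<beta> v"
    proof (cases "v \<in> V")
      case True
      then show ?thesis using w[of "lookup \<mu>" "lookup \<beta>"] that B \<beta> by (auto simp: S_def)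
    next
      case False
      then show ?thesis using that \<beta> by (auto simp: V_def S_def in_keys_iff)
    qed
  qed
  have wt: "monomial_value (\<lambda>i. [:0, monom 1 (w i):]) \<mu> = monom (monom (1::'a) (?wt \<mu>)) (mdegree \<mu>)" if "\<mu> \<in> keys S" for \<mu>
  proof -
    have e: "[:0, monom 1 (w i):] = monom (monom (1::'a) (w i)) 1" for i
      by (simp add: monom_altdef)
    have "monomial_value (\<lambda>i. [:0, monom 1 (w i):]) \<mu> = (\<Prod>v\<in>keys \<mu>. monom (monom (1::'a) (w v * lookup \<mu> v)) (lookup \<mu> v))"
      by (simp add: monomial_value_def e monom_power)
    also have "\<dots> = monom (monom 1 (\<Sum>v\<in>keys \<mu>. w v * lookup \<mu> v)) (mdegree \<mu>)"
    proof -
      have "(\<Prod>v\<in>A. monom (monom (1::'a) (f v)) (g v)) = monom (monom 1 (sum f A)) (sum g A)" if "finite A"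
        for A and f g :: "'v \<Rightarrow> nat"
        using that by (induction A) (auto simp: mult_monom)
      then show ?thesis by (simp add: mdegree_def)
    qed
    also have "(\<Sum>v\<in>keys \<mu>. w v * lookup \<mu> v) = ?wt \<mu>"
      using fV that by (intro sum.mono_neutral_left) (auto simp: V_def in_keys_iff)
    finally show ?thesis .
  qed
  let ?G = "taylorP F (mdegree \<beta>) (\<lambda>i. [:x i:]) (\<lambda>i. monom 1 (w i))"
  have "?G = 0"
    by (rule poly_eq_0_of_cofinite_zeros[of "{}"]) (simp_all add: poly_taylorP assms[OF d])
  moreover have "coeff ?G (?wt \<beta>) = lookup S \<beta>"
  proof -
    have "on_line (\<lambda>c. [:c:]) F (\<lambda>i. [:x i:]) (\<lambda>i. monom 1 (w i)) = 
        msubst (\<lambda>c. [:[:c:]:]) (\<lambda>i. [:0, monom 1 (w i):]) S"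
      unfolding msubst_shift[OF is_ring_hom_const_poly[OF is_ring_hom_pconst]] on_line_def S_def by simp
    also have "\<dots> = (\<Sum>\<mu>\<in>keys S. monom (monom (lookup S \<mu>) (?wt \<mu>)) (mdegree \<mu>))"
      by (simp add: msubst_altdef wt smult_monom)
    finally have "coeff ?G (?wt \<beta>) = (\<Sum>\<mu>\<in>keys S. coeff (coeff (monom (monom (lookup S \<mu>) (?wt \<mu>)) (mdegree \<mu>)) (mdegree \<beta>)) (?wt \<beta>))"
      by (simp add: taylor_def coeff_sum)
    also have "\<dots> = (\<Sum>\<mu>\<in>keys S. if \<mu> = \<beta> then lookup S \<mu> else 0)"
      by (intro sum.cong) (auto dest: inj)
    also have "\<dots> = lookup S \<beta>"
      using \<beta> by (simp add: S_def)
    finally show ?thesis .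
  qed
  ultimately show False using \<beta> by (simp add: S_def in_keys_iff)
qed

section \<open>Bihomogeneous forms, scaling and joins\<close>

definition bi_scale :: "'b::comm_ring_1 \<Rightarrow> 'b \<Rightarrow> (nat + nat \<Rightarrow> 'b) \<Rightarrow> nat + nat \<Rightarrow> 'b"
  where "bi_scale a b x = case_sum (\<lambda>i. a * x (Inl i)) (\<lambda>j. b * x (Inr j))"

lemma bi_scale_simps [simp]: "bi_scale a b x (Inl i) = a * x (Inl i)" "bi_scale a b x (Inr j) = b * x (Inr j)"
  by (simp_all add: bi_scale_def)

lemma bihomogeneousD:
  assumes "bihomogeneous n d1 d2 F" "\<mu> \<in> keys F"
  shows "keys \<mu> \<subseteq> Inl ` {..n} \<union> Inr ` {..Suc n}"
    "(\<Sum>i\<le>n. lookup \<mu> (Inl i)) = nat d1" "(\<Sum>j\<le>Suc n. lookup \<mu> (Inr j)) = nat d2"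
    "d1 \<ge> 0" "d2 \<ge> 0"
proof -
  have *: "keys \<mu> \<subseteq> Inl ` {..n} \<union> Inr ` {..Suc n}" "int (\<Sum>i\<le>n. lookup \<mu> (Inl i)) = d1"
    "int (\<Sum>j\<le>Suc n. lookup \<mu> (Inr j)) = d2"
    using assms unfolding bihomogeneous_def Suc_eq_plus1 by blast+
  show "keys \<mu> \<subseteq> Inl ` {..n} \<union> Inr ` {..Suc n}" by fact
  show "(\<Sum>i\<le>n. lookup \<mu> (Inl i)) = nat d1" "(\<Sum>j\<le>Suc n. lookup \<mu> (Inr j)) = nat d2"
    unfolding *(2,3)[symmetric] by (simp_all only: nat_int)
  show "d1 \<ge> 0" "d2 \<ge> 0" unfolding *(2,3)[symmetric] by (rule of_nat_0_le_iff)+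
qed

lemma monomial_value_two_blocks:
  assumes "keys \<mu> \<subseteq> Inl ` {..n} \<union> Inr ` {..Suc n}"
  shows "monomial_value \<sigma> \<mu> = (\<Prod>i\<le>n. \<sigma> (Inl i) ^ lookup \<mu> (Inl i)) * (\<Prod>j\<le>Suc n. \<sigma> (Inr j) ^ lookup \<mu> (Inr j))"
proof -
  have "monomial_value \<sigma> \<mu> = (\<Prod>v\<in>Inl ` {..n} \<union> Inr ` {..Suc n}. \<sigma> v ^ lookup \<mu> v)"
    by (rule monomial_value_superset[OF _ assms]) auto
  also have "\<dots> = (\<Prod>v\<in>Inl ` {..n}. \<sigma> v ^ lookup \<mu> v) * (\<Prod>v\<in>Inr ` {..Suc n}. \<sigma> v ^ lookup \<mu> v)"
    by (rule prod.union_disjoint) auto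
  finally show ?thesis by (simp add: prod.reindex)
qed

lemma sum_two_blocks:
  fixes \<omega> :: "nat + nat \<Rightarrow> nat"
  assumes "keys \<mu> \<subseteq> Inl ` {..n} \<union> Inr ` {..Suc n}"
  shows "(\<Sum>v\<in>keys \<mu>. \<omega> v * lookup \<mu> v) = (\<Sum>i\<le>n. \<omega> (Inl i) * lookup \<mu> (Inl i)) + (\<Sum>j\<le>Suc n. \<omega> (Inr j) * lookup \<mu> (Inr j))"
proof -
  have "(\<Sum>v\<in>keys \<mu>. \<omega> v * lookup \<mu> v) = (\<Sum>v\<in>Inl ` {..n} \<union> Inr ` {..Suc n}. \<omega> v * lookup \<mu> v)"
    by (rule sum.mono_neutral_left) (use assms in \<open>auto simp: in_keys_iff\<close>)
  also have "\<dots> = (\<Sum>v\<in>Inl ` {..n}. \<omega> v * lookup \<mu> v) + (\<Sum>v\<in>Inr ` {..Suc n}. \<omega> v * lookup \<mu> v)"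
    by (rule sum.union_disjoint) auto
  finally show ?thesis by (simp add: sum.reindex)
qed

lemma bihomogeneous_weight:
  assumes "bihomogeneous n d1 d2 F" "\<mu> \<in> keys F"
  shows "(\<Sum>v\<in>keys \<mu>. case_sum (\<lambda>_. a) (\<lambda>_. b) v * lookup \<mu> v) = a * nat d1 + b * nat d2"
  by (simp add: sum_two_blocks[OF bihomogeneousD(1)[OF assms]] sum_distrib_left[symmetric] bihomogeneousD[OF assms] del: sum.atMost_Suc)

lemma msubst_bi_scale:
  assumes h: "is_ring_hom h" and F: "bihomogeneous n d1 d2 F"
  shows "msubst h (bi_scale a b x) F = a ^ nat d1 * b ^ nat d2 * msubst h x F"
proof -
  have "monomial_value (bi_scale a b x) \<mu> = a ^ nat d1 * b ^ nat d2 * monomial_value x \<mu>" if "\<mu> \<in> keys F" for \<mu>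
    unfolding monomial_value_two_blocks[OF bihomogeneousD(1)[OF F that]]
    by (simp add: power_mult_distrib prod.distrib power_sum[symmetric] bihomogeneousD[OF F that] del: prod.atMost_Suc sum.atMost_Suc)
  then show ?thesis
    by (simp add: msubst_altdef sum_distrib_left mult_ac)
qed

lemma taylor_bi_scale:
  assumes h: "is_ring_hom h" and F: "bihomogeneous n d1 d2 F"
  shows "taylor h F r (bi_scale a b x) (bi_scale a b v) = a ^ nat d1 * b ^ nat d2 * taylor h F r x v"
proof -
  have "(\<lambda>i. [:bi_scale a b x i, bi_scale a b v i:]) = bi_scale [:a:] [:b:] (\<lambda>i. [:x i, v i:])"
  proof
    fix i show "[:bi_scale a b x i, bi_scale a b v i:] = bi_scale [:a:] [:b:] (\<lambda>i. [:x i, v i:]) i" by (cases i) simp_all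
  qed
  then have "on_line h F (bi_scale a b x) (bi_scale a b v) = [:a ^ nat d1 * b ^ nat d2:] * on_line h F x v"
    unfolding on_line_def by (simp add: msubst_bi_scale[OF is_ring_hom_const_poly[OF h] F] poly_const_pow mult.commute)
  then show ?thesis by (simp add: taylor_def)
qed

text \<open>
The order of vanishing is upper semicontinuous, because for a fixed direction each Taylor coefficient
is a polynomial in the parameter of the curve.
\<close>

lemma ord_ge_limit:
  fixes X :: "'v \<Rightarrow> 'a::field_char_0 poly"
  assumes "finite T" "\<And>t. t \<notin> T \<Longrightarrow> ord_ge (\<lambda>i. poly (X i) t) F m"
  shows "ord_ge (\<lambda>i. poly (X i) t) F m"
proof (rule ord_geI)
  fix r v assume r: "int r < m"
  have "taylorP F r X (\<lambda>i. [:v i:]) = 0"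
    using assms(1) by (rule poly_eq_0_of_cofinite_zeros) (use taylorK_eq_0[OF assms(2) r] in \<open>simp add: poly_taylorP\<close>)
  then have "poly (taylorP F r X (\<lambda>i. [:v i:])) t = 0" by simp
  then show "taylorK F r (\<lambda>i. poly (X i) t) v = 0" by (simp add: poly_taylorP)
qed

text \<open>
For nonzero \<open>a\<close> and \<open>b\<close> the point of the product stays the same; semicontinuity adds the
degenerate factors, which occur for the points of a span that lie in the span of fewer points.
\<close>

lemma ord_ge_bi_scale:
  fixes x :: "nat + nat \<Rightarrow> 'a::field_char_0"
  assumes F: "bihomogeneous n d1 d2 F" and x: "ord_ge x F m"
  shows "ord_ge (bi_scale a b x) F m"
proof -
  have 1: "ord_ge (bi_scale a b x) F m" if "a \<noteq> 0" "b \<noteq> 0" for a b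
  proof (rule ord_geI)
    fix r v assume r: "int r < m"
    have "v = bi_scale a b (bi_scale (1 / a) (1 / b) v)"
      using that by (auto simp: bi_scale_def split: sum.splits)
    then have "taylorK F r (bi_scale a b x) v = taylorK F r (bi_scale a b x) (bi_scale a b (bi_scale (1 / a) (1 / b) v))" by simp
    then show "taylorK F r (bi_scale a b x) v = 0"
      by (simp add: taylor_bi_scale[OF is_ring_hom_ident F] taylorK_eq_0[OF x r])
  qed
  have 2: "ord_ge (bi_scale a b x) F m" if "b \<noteq> 0" for a b
  proof -
    have e: "(\<lambda>i. poly (bi_scale [:0, 1:] [:b:] (\<lambda>i. [:x i:]) i) t) = bi_scale t b x" for t
      by (auto simp: bi_scale_def split: sum.splits)
    show ?thesis
      using ord_ge_limit[of "{0}" "bi_scale [:0, 1:] [:b:] (\<lambda>i. [:x i:])" F m a] 1 that by (simp add: e)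
  qed
  have e: "(\<lambda>i. poly (bi_scale [:a:] [:0, 1:] (\<lambda>i. [:x i:]) i) t) = bi_scale a t x" for t
    by (auto simp: bi_scale_def split: sum.splits)
  show ?thesis
    using ord_ge_limit[of "{0}" "bi_scale [:a:] [:0, 1:] (\<lambda>i. [:x i:])" F m b] 2 by (simp add: e)
qed

text \<open>
Let \<open>g(\<tau>) = F\<^sub>q(x + \<tau> y; v)\<close> and \<open>T = d1 + d2\<close>.  The order at \<open>x\<close> makes \<open>g\<close> divisible by
\<open>\<tau>^(a - q)\<close>.  By homogeneity \<open>\<tau>^q g(\<tau>) = \<tau>^T h(1 / \<tau>)\<close> for \<open>h(\<sigma>) = F\<^sub>q(\<sigma> x + y; v)\<close>, and the order at
\<open>y\<close> makes \<open>h\<close> divisible by \<open>\<sigma>^(b - q)\<close>, so \<open>g\<close> has degree at most \<open>T - b\<close>.  So \<open>g \<noteq> 0\<close>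
implies \<open>a - q \<le> T - b\<close>.
\<close>

lemma ord_ge_join:
  fixes x y :: "nat + nat \<Rightarrow> 'a::field_char_0"
  assumes F: "bihomogeneous n d1 d2 F" and "d1 \<ge> 0" "d2 \<ge> 0"
    and x: "ord_ge x F a" and y: "ord_ge y F b"
  shows "ord_ge (\<lambda>i. x i + y i) F (a + b - (d1 + d2))"
proof (rule ord_geI)
  fix q v assume q: "int q < a + b - (d1 + d2)"
  define T where "T = nat d1 + nat d2"
  define g where "g = taylorP F q (\<lambda>i. [:x i, y i:]) (\<lambda>i. [:v i:])"
  define h where "h = taylorP F q (\<lambda>i. [:y i, x i:]) (\<lambda>i. [:v i:])"
  define k where "k = nat (b - int q)"
  have gh: "\<tau> ^ q * poly g \<tau> = \<tau> ^ T * poly h (inverse \<tau>)" if "\<tau> \<noteq> 0" for \<tau>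
  proof -
    let ?z = "\<lambda>i. y i + inverse \<tau> * x i"
    have "taylorK F q (bi_scale \<tau> \<tau> ?z) (bi_scale \<tau> \<tau> v) = \<tau> ^ T * taylorK F q ?z v"
      by (simp add: taylor_bi_scale[OF is_ring_hom_ident F] T_def power_add)
    moreover have "bi_scale \<tau> \<tau> ?z = (\<lambda>i. x i + \<tau> * y i)"
      using that by (auto simp: bi_scale_def fun_eq_iff algebra_simps split: sum.splits)
    moreover have "bi_scale \<tau> \<tau> v = (\<lambda>i. \<tau> * v i)"
      by (auto simp: bi_scale_def split: sum.splits)
    ultimately show ?thesis
      by (simp add: g_def h_def poly_taylorP taylor_scale[OF is_ring_hom_ident])
  qed
  have "[:-0, 1:] ^ k dvd h"
    unfolding h_def k_def by (rule dvd_taylorP[OF y]) simp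
  then obtain h' where h': "h = [:0, 1:] ^ k * h'" by (auto simp: dvd_def)
  define e where "e = degree h'"
  \<comment> \<open>the relation \<open>gh\<close> cleared of denominators\<close>
  have "monom 1 (q + k + e) * g - monom 1 T * reflect_poly h' = 0"
  proof (rule poly_eq_0_of_cofinite_zeros[of "{0}"])
    fix \<tau> :: 'a assume "\<tau> \<notin> {0}"
    then have \<tau>: "\<tau> \<noteq> 0" by simp
    have "poly (monom 1 (q + k + e) * g) \<tau> = \<tau> ^ (k + e) * (\<tau> ^ q * poly g \<tau>)"
      by (simp add: poly_monom power_add mult_ac)
    also have "\<dots> = \<tau> ^ (k + e) * (\<tau> ^ T * (inverse \<tau> ^ k * poly h' (inverse \<tau>)))"
      by (simp only: gh[OF \<tau>] h' poly_mult poly_power) simp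
    also have "\<dots> = \<tau> ^ T * (\<tau> ^ k * inverse \<tau> ^ k) * (\<tau> ^ e * poly h' (inverse \<tau>))"
      by (simp only: power_add mult_ac)
    also have "\<tau> ^ k * inverse \<tau> ^ k = 1"
      using \<tau> by (simp add: power_mult_distrib[symmetric])
    also have "\<tau> ^ e * poly h' (inverse \<tau>) = poly (reflect_poly h') \<tau>"
      by (simp add: poly_reflect_poly_nz[OF \<tau>] e_def)
    finally show "poly (monom 1 (q + k + e) * g - monom 1 T * reflect_poly h') \<tau> = 0"
      by (simp add: poly_monom)
  qed simp
  then have eq: "monom 1 (q + k + e) * g = monom 1 T * reflect_poly h'" by simp
  have "g = 0"
  proof (rule ccontr)
    assume "g \<noteq> 0"
    then have "q + k + e + degree g = degree (monom 1 (q + k + e) * g)"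
      by (simp add: degree_mult_eq degree_monom_eq monom_eq_0_iff)
    also have "\<dots> \<le> T + e"
      unfolding eq using degree_mult_le[of "monom 1 T" "reflect_poly h'"] degree_reflect_poly_le[of h']
      by (simp add: degree_monom_eq e_def)
    finally have 1: "q + k + degree g \<le> T" by simp
    have "[:-0, 1:] ^ nat (a - int q) dvd g"
      unfolding g_def by (rule dvd_taylorP[OF x]) simp
    from dvd_imp_degree_le[OF this \<open>g \<noteq> 0\<close>] have "nat (a - int q) \<le> degree g"
      by (simp add: degree_power_eq)
    with 1 q assms(2,3) show False unfolding k_def T_def by linarith
  qed
  then have "poly g 1 = 0" by simp
  then show "taylorK F q (\<lambda>i. x i + y i) v = 0" by (simp add: g_def poly_taylorP)
qed

text \<open>
With this value the empty list satisfies the bound of the next lemma, in which every further point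
costs \<open>d1 + d2\<close>.
\<close>

lemma ord_ge_origin:
  assumes F: "bihomogeneous n d1 d2 F"
  shows "ord_ge (\<lambda>i. 0) F (d1 + d2)"
  unfolding ord_ge_def shift_0
proof
  fix \<mu> assume \<mu>: "\<mu> \<in> keys F"
  have "mdegree \<mu> = (\<Sum>v\<in>keys \<mu>. case_sum (\<lambda>_. 1) (\<lambda>_. 1) v * lookup \<mu> v)"
    by (auto simp: mdegree_def intro!: sum.cong split: sum.splits)
  then show "d1 + d2 \<le> int (mdegree \<mu>)"
    using bihomogeneous_weight[OF F \<mu>, of 1 1] bihomogeneousD[OF F \<mu>] by simp
qed

lemma ord_ge_span:
  fixes F :: "(nat + nat, 'a::field_char_0) mpoly"
  assumes F: "bihomogeneous n d1 d2 F" "d1 \<ge> 0" "d2 \<ge> 0"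
    and "list_all2 (\<lambda>z a. ord_ge (coords z) F a) zs as"
    and "u \<in> fv.span (fst ` set zs)" "w \<in> fv.span (snd ` set zs)"
  shows "ord_ge (case_sum u w) F (sum_list as - (int (length zs) - 1) * (d1 + d2))"
  using assms(4-)
proof (induction zs as arbitrary: u w rule: list_all2_induct)
  case Nil
  then have "case_sum u w = (\<lambda>i. 0)" by (auto simp: fun_eq_iff split: sum.splits)
  then have "ord_ge (case_sum u w) F (d1 + d2)" by (simp only: ord_ge_origin[OF F(1)])
  then show ?case by (simp add: add.commute)
next
  case (Cons z zs a as)
  from Cons.prems obtain c where c: "u - vscale c (fst z) \<in> fv.span (fst ` set zs)"
    by (auto simp: fv.span_insert)
  from Cons.prems obtain e where e: "w - vscale e (snd z) \<in> fv.span (snd ` set zs)"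
    by (auto simp: fv.span_insert)
  have "(\<lambda>i. bi_scale c e (coords z) i + case_sum (u - vscale c (fst z)) (w - vscale e (snd z)) i) = case_sum u w"
    by (auto simp: fun_eq_iff bi_scale_def vscale_def split: sum.splits)
  then show ?case
    using ord_ge_join[OF F ord_ge_bi_scale[OF F(1) Cons.hyps(1), of c e] Cons.IH[OF c e]]
    by (simp add: algebra_simps)
qed

section \<open>Leading terms of a form on a curve\<close>

text \<open>
If the terms of order less than \<open>r\<close> vanish along the curve, then the leading term of
\<open>F(X(e) + e V(e))\<close> at \<open>e = 0\<close> involves only the values of \<open>X\<close> and \<open>V\<close> at \<open>0\<close>.
\<close>

lemma coeff_msubst_curve:
  fixes X V :: "'v \<Rightarrow> 'a::field_char_0 poly"
  assumes "\<And>e \<rho>. \<rho> < r \<Longrightarrow> taylorK F \<rho> (\<lambda>i. poly (X i) e) (\<lambda>i. poly (V i) e) = 0"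
  shows "coeff (msubst (\<lambda>c. [:c:]) (\<lambda>i. X i + [:0, 1:] * V i) F) r
       = taylorK F r (\<lambda>i. poly (X i) 0) (\<lambda>i. poly (V i) 0)"
proof -
  define P where "P = on_line (\<lambda>c. [:c:]) F X V"
  have P0: "coeff P \<rho> = 0" if "\<rho> < r" for \<rho>
  proof -
    have "taylorP F \<rho> X V = 0"
      by (rule poly_eq_0_of_cofinite_zeros[of "{}"]) (simp_all add: poly_taylorP assms[OF that])
    then show ?thesis by (simp add: P_def taylor_def)
  qed
  have Pr: "poly (coeff P r) 0 = taylorK F r (\<lambda>i. poly (X i) 0) (\<lambda>i. poly (V i) 0)"
    unfolding P_def taylor_def[symmetric] by (rule poly_taylorP)
  have "msubst (\<lambda>c. [:c:]) (\<lambda>i. X i + [:0, 1:] * V i) F = poly P [:0, 1:]"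
    unfolding P_def by (rule poly_on_line[OF is_ring_hom_pconst, symmetric])
  also have "\<dots> = (\<Sum>i\<le>max r (degree P). coeff P i * monom 1 i)"
    unfolding poly_altdef by (rule sum.mono_neutral_cong_left) (auto simp: monom_altdef coeff_eq_0)
  finally have "coeff (msubst (\<lambda>c. [:c:]) (\<lambda>i. X i + [:0, 1:] * V i) F) r
      = (\<Sum>i\<le>max r (degree P). coeff (coeff P i * monom 1 i) r)"
    by (simp add: coeff_sum)
  also have "\<dots> = (\<Sum>i\<le>max r (degree P). if i = r then coeff (coeff P r) 0 else 0)"
  proof (rule sum.cong)
    fix i
    show "coeff (coeff P i * monom 1 i) r = (if i = r then coeff (coeff P r) 0 else 0)"
      using P0[of i] coeff_monom_mult[of 1 i "coeff P i" r] by (auto simp: mult.commute)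
  qed simp
  also have "\<dots> = poly (coeff P r) 0" by (simp add: poly_0_coeff_0)
  finally show ?thesis by (simp add: Pr)
qed

text \<open>
Expand \<open>F(X(e) + e v)\<close> at \<open>e = 0\<close> in two ways, with base point \<open>X(e)\<close> and with base point \<open>X(0)\<close>.  In
the second one the direction at \<open>e = 0\<close> is \<open>v + X'(0)\<close>.
\<close>

lemma taylor_tangent:
  fixes X :: "'v \<Rightarrow> 'a::field_char_0 poly"
  assumes X: "\<And>e. ord_ge (\<lambda>i. poly (X i) e) F (int r)"
  shows "taylorK F r (\<lambda>i. poly (X i) 0) (\<lambda>i. v i + poly (pderiv (X i)) 0) = taylorK F r (\<lambda>i. poly (X i) 0) v"
proof -
  have "\<forall>i. \<exists>X1. X i = [:poly (X i) 0:] + [:0, 1:] * X1"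
  proof
    fix i show "\<exists>X1. X i = [:poly (X i) 0:] + [:0, 1:] * X1" by (cases "X i") auto
  qed
  then obtain X1 where X1: "\<And>i. X i = [:poly (X i) 0:] + [:0, 1:] * X1 i" by metis
  have d: "poly (pderiv (X i)) 0 = poly (X1 i) 0" for i
    by (subst X1) (simp add: pderiv_pCons)
  have z: "taylorK F \<rho> (\<lambda>i. poly (X i) e) w = 0" if "\<rho> < r" for \<rho> e w
    using taylorK_eq_0[OF X] that by simp
  let ?p = "msubst (\<lambda>c. [:c:]) (\<lambda>i. X i + [:0, 1:] * [:v i:]) F"
  have "?p = msubst (\<lambda>c. [:c:]) (\<lambda>i. [:poly (X i) 0:] + [:0, 1:] * (X1 i + [:v i:])) F"
  proof -
    have "X i + [:0, 1:] * [:v i:] = [:poly (X i) 0:] + [:0, 1:] * (X1 i + [:v i:])" for i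
      using X1[of i] by (metis (no_types, lifting) add.assoc distrib_left)
    then show ?thesis by simp
  qed
  moreover have "coeff ?p r = taylorK F r (\<lambda>i. poly (X i) 0) v"
    by (subst coeff_msubst_curve) (simp_all add: z)
  moreover have "coeff (msubst (\<lambda>c. [:c:]) (\<lambda>i. [:poly (X i) 0:] + [:0, 1:] * (X1 i + [:v i:])) F) r
      = taylorK F r (\<lambda>i. poly (X i) 0) (\<lambda>i. v i + poly (pderiv (X i)) 0)"
    by (subst coeff_msubst_curve) (simp_all add: z d add.commute)
  ultimately show ?thesis by simp
qed

text \<open>
The previous lemma for a curve in the cone over the image of \<open>\<phi>\<close> that moves along \<open>\<phi>\<close> with speed
\<open>\<beta>\<close> while the two factors are rescaled with speeds \<open>\<alpha>1\<close> and \<open>\<alpha>2\<close>.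
\<close>

lemma taylor_tangent_cone:
  fixes \<phi> :: "nat + nat \<Rightarrow> 'a::field_char_0 poly"
  assumes F: "bihomogeneous n d1 d2 F"
    and \<phi>: "\<And>t. ord_ge (\<lambda>i. poly (\<phi> i) t) F (int r)"
  shows "taylorK F r (\<lambda>i. poly (\<phi> i) t) (\<lambda>i. v i + (bi_scale \<alpha>1 \<alpha>2 (\<lambda>i. poly (\<phi> i) t) i + \<beta> * poly (pderiv (\<phi> i)) t))
       = taylorK F r (\<lambda>i. poly (\<phi> i) t) v"
proof -
  define X where "X = bi_scale [:1, \<alpha>1:] [:1, \<alpha>2:] (\<lambda>i. pcompose (\<phi> i) [:t, \<beta>:])"
  have e: "(\<lambda>i. poly (X i) e) = bi_scale (1 + e * \<alpha>1) (1 + e * \<alpha>2) (\<lambda>i. poly (\<phi> i) (t + e * \<beta>))" for e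
    by (auto simp: X_def bi_scale_def poly_pcompose fun_eq_iff algebra_simps split: sum.splits)
  have "(\<lambda>i. poly (X i) 0) = (\<lambda>i. poly (\<phi> i) t)"
    unfolding e by (auto simp: bi_scale_def fun_eq_iff split: sum.splits)
  moreover have "poly (pderiv (X i)) 0 = bi_scale \<alpha>1 \<alpha>2 (\<lambda>i. poly (\<phi> i) t) i + \<beta> * poly (pderiv (\<phi> i)) t" for i
    by (cases i) (simp_all add: X_def pderiv_mult pderiv_pcompose pderiv_pCons poly_pcompose del: mult_pCons_left mult_pCons_right)
  ultimately show ?thesis
    using taylor_tangent[of X F r v] ord_ge_bi_scale[OF F \<phi>] by (simp add: e)
qed

lemma degree_taylorP_le:
  assumes F: "bihomogeneous n d1 d2 F"
    and \<phi>: "\<And>i. degree (\<phi> (Inl i)) \<le> a" "\<And>j. degree (\<phi> (Inr j)) \<le> b"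
    and V: "\<And>i. degree (V (Inl i)) \<le> a + e" "\<And>j. degree (V (Inr j)) \<le> b + e"
  shows "degree (taylorP F r \<phi> V) \<le> a * nat d1 + b * nat d2 + e * r"
proof -
  define P where "P w p \<longleftrightarrow> (\<forall>q. degree (coeff p q) \<le> w + e * q)" for w and p :: "'a poly poly"
  have "P (a * nat d1 + b * nat d2) (on_line (\<lambda>c. [:c:]) F \<phi> V)"
    unfolding on_line_def
  proof (rule msubst_filtered[where \<omega> = "case_sum (\<lambda>_. a) (\<lambda>_. b)"])
    show "P (u + w) (p * q)" if p: "P u p" and q: "P w q" for u w p q
      unfolding P_def
    proof
      fix k
      have "degree (coeff p i * coeff q (k - i)) \<le> u + w + e * k" if "i \<le> k" for i
      proof -
        have "degree (coeff p i * coeff q (k - i)) \<le> (u + e * i) + (w + e * (k - i))"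
          using p q degree_mult_le[of "coeff p i" "coeff q (k - i)"] by (fastforce simp: P_def intro: order_trans add_mono)
        also have "\<dots> = u + w + e * k" using that by (simp add: distrib_left[symmetric])
        finally show ?thesis .
      qed
      then show "degree (coeff (p * q) k) \<le> u + w + e * k"
        by (auto simp: coeff_mult intro!: degree_sum_le)
    qed
    show "P (case_sum (\<lambda>_. a) (\<lambda>_. b) i) [:\<phi> i, V i:]" for i
      unfolding P_def
    proof
      fix q show "degree (coeff [:\<phi> i, V i:] q) \<le> case_sum (\<lambda>_. a) (\<lambda>_. b) i + e * q"
        using \<phi> V by (cases i; cases q) (auto simp: coeff_pCons split: nat.splits)
    qed
    show "P (a * nat d1 + b * nat d2) p" if "\<mu> \<in> keys F" "P (\<Sum>v\<in>keys \<mu>. case_sum (\<lambda>_. a) (\<lambda>_. b) v * lookup \<mu> v) p" for \<mu> p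
      using that(2) bihomogeneous_weight[OF F that(1), of a b] by simp
    show "P (a * nat d1 + b * nat d2) (p + q)" if "P (a * nat d1 + b * nat d2) p" "P (a * nat d1 + b * nat d2) q" for p q
      using that by (auto simp: P_def intro: degree_add_le)
  qed (auto simp: P_def coeff_pCons split: nat.splits)
  then show ?thesis by (simp add: taylor_def P_def)
qed

lemma sum_root_orders_le_degree:
  fixes p :: "'a::field poly"
  assumes "finite J" "inj_on c J" "p \<noteq> 0" "\<And>j. j \<in> J \<Longrightarrow> [:- c j, 1:] ^ E j dvd p"
  shows "(\<Sum>j\<in>J. E j) \<le> degree p"
proof -
  have "(\<Sum>j\<in>J. E j) \<le> (\<Sum>j\<in>J. order (c j) p)"
    using assms by (intro sum_mono) (simp add: order_divides)
  also have "\<dots> = (\<Sum>x\<in>c ` J. order x p)"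
    using assms(2) by (simp add: sum.reindex)
  also have "\<dots> = (\<Sum>x\<in>c ` J \<inter> {x. poly p x = 0}. order x p)"
    using assms by (intro sum.mono_neutral_right) (auto simp: order_0I)
  also have "\<dots> \<le> (\<Sum>x | poly p x = 0. order x p)"
    using poly_roots_finite[OF assms(3)] by (intro sum_mono2) auto
  also have "\<dots> \<le> degree p"
    by (rule sum_order_le_degree[OF assms(3)])
  finally show ?thesis .
qed

text \<open>
Applied to the coordinates of a curve \<open>\<phi>\<close>, this says that the vector \<open>\<phi>(c)\<close> agrees with a tangent
vector of the cone at \<open>\<phi>(t)\<close> up to an error divisible by \<open>(t - c)\<^sup>2\<close>.
\<close>

lemma linear_taylor_second_order:
  fixes p :: "'a::field poly"
  shows "\<exists>\<psi>. [:poly p c:] = p - [:- c, 1:] * pderiv p + [:- c, 1:] ^ 2 * \<psi>"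
proof -
  have "[:- c, 1:] dvd p - [:poly p c:]"
    by (subst poly_eq_0_iff_dvd[symmetric]) simp
  then obtain s where "p - [:poly p c:] = [:- c, 1:] * s" by (auto simp: dvd_def)
  then have s: "p = [:poly p c:] + [:- c, 1:] * s" by (metis add.commute diff_add_cancel)
  have "pderiv p = s + [:- c, 1:] * pderiv s"
    by (subst s) (simp add: pderiv_add pderiv_mult pderiv_pCons del: mult_pCons_left)
  then have "p - [:- c, 1:] * pderiv p + [:- c, 1:] ^ 2 * pderiv s = p - [:- c, 1:] * s"
    by (simp add: algebra_simps power2_eq_square del: mult_pCons_left mult_pCons_right)
  also have "\<dots> = [:poly p c:]" by (subst s) simp
  finally show ?thesis by metis
qed

lemma taylor_cong:
  assumes F: "bihomogeneous n d1 d2 F"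
    and "\<And>i. i \<le> n \<Longrightarrow> v (Inl i) = w (Inl i)" "\<And>j. j \<le> Suc n \<Longrightarrow> v (Inr j) = w (Inr j)"
  shows "taylor h F r x v = taylor h F r x w"
proof -
  have "monomial_value (\<lambda>i. [:x i, v i:]) \<mu> = monomial_value (\<lambda>i. [:x i, w i:]) \<mu>" if "\<mu> \<in> keys F" for \<mu>
    unfolding monomial_value_two_blocks[OF bihomogeneousD(1)[OF F that]] using assms(2,3) by simp
  then show ?thesis by (simp add: taylor_def on_line_def msubst_altdef)
qed

text \<open>
The explicit form of the statement that a sum of line bundles of negative degree has no sections.
The directions \<open>V\<close> combine the marked points, with coefficients chosen so that modulo
the tangent space of the cone they have a double zero at every marked parameter.  The
second projection of a marked point is tangent at this point up to first order, by rescaling of the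
second factor, so that its coefficient \<open>Q * R j\<close> only needs a simple zero at \<open>q j\<close>.
\<close>

lemma curve_leading_term_vanishes:
  fixes F :: "(nat + nat, 'a::field_char_0) mpoly" and \<phi> :: "nat + nat \<Rightarrow> 'a poly"
  assumes F: "bihomogeneous n d1 d2 F" "d1 \<ge> 0" "d2 \<ge> 0"
    and \<phi>: "\<And>i. degree (\<phi> (Inl i)) \<le> n" "\<And>j. degree (\<phi> (Inr j)) \<le> n + 1"
    and J: "finite J" "card J = n + 3" "inj_on q J"
    and m: "\<And>j. j \<in> J \<Longrightarrow> ord_ge (\<lambda>i. poly (\<phi> i) (q j)) F (m j)"
    and span1: "\<And>v :: nat \<Rightarrow> 'a. \<exists>lam. \<forall>i\<le>n. v i = (\<Sum>j\<in>J. lam j * poly (\<phi> (Inl i)) (q j))"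
    and span2: "\<And>v :: nat \<Rightarrow> 'a. \<exists>lam. \<forall>i\<le>Suc n. v i = (\<Sum>j\<in>J. lam j * poly (\<phi> (Inr i)) (q j))"
    and r: "\<And>t. ord_ge (\<lambda>i. poly (\<phi> i) t) F (int r)"
    and less: "int r < (\<Sum>j\<in>J. m j) - (int n * d1 + (int n + 1) * d2)"
  shows "taylorK F r (\<lambda>i. poly (\<phi> i) t) w = 0"
proof -
  define L where "L j = [:- q j, 1:]" for j
  define Q where "Q = (\<Prod>j\<in>J. L j)"
  define R where "R j = (\<Prod>i\<in>J - {j}. L i)" for j
  define b where "b j v = poly (\<phi> v) (q j)" for j v
  define c :: "('b \<Rightarrow> 'a) \<Rightarrow> ('b \<Rightarrow> 'a) \<Rightarrow> 'b \<Rightarrow> nat + nat \<Rightarrow> 'a poly" where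
    "c lam \<kappa> j = case_sum (\<lambda>_. [:lam j:] * R j ^ 2) (\<lambda>_. [:lam j:] * R j ^ 2 + [:\<kappa> j:] * (Q * R j))" for lam \<kappa> j
  define V where "V lam \<kappa> v = (\<Sum>j\<in>J. [:b j v:] * c lam \<kappa> j v)" for lam \<kappa> v
  have Q: "Q = L j * R j" if "j \<in> J" for j
    unfolding Q_def R_def using J(1) that by (rule prod.remove)
  have LR: "L j dvd R i" if "i \<noteq> j" "j \<in> J" for i j
    unfolding R_def using J(1) that by (intro dvd_prodI) auto
  have dR: "degree (R j) \<le> n + 2" if "j \<in> J" for j
  proof -
    have "degree (R j) \<le> (\<Sum>i\<in>J - {j}. degree (L i))"
      unfolding R_def using degree_prod_sum_le[of "J - {j}" L] J(1) by (simp add: comp_def)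
    also have "\<dots> = n + 2" using J that by (simp add: L_def)
    finally show ?thesis .
  qed
  have G0: "taylorP F r \<phi> (V lam \<kappa>) = 0" for lam \<kappa>
  proof (rule ccontr)
    let ?G = "taylorP F r \<phi> (V lam \<kappa>)"
    assume ne: "?G \<noteq> 0"
    have dR2: "degree ([:x:] * R j ^ 2) \<le> 2 * n + 4" if "j \<in> J" for x j
      using degree_mult_le[of "[:x:]" "R j ^ 2"] degree_power_le[of "R j" 2] dR[OF that] by simp
    have dQR: "degree ([:x:] * (Q * R j)) \<le> 2 * n + 5" if "j \<in> J" for x j
    proof -
      have "[:x:] * (Q * R j) = L j * ([:x:] * R j ^ 2)"
        by (simp add: Q[OF that] power2_eq_square mult_ac)
      then have "degree ([:x:] * (Q * R j)) \<le> degree (L j) + degree ([:x:] * R j ^ 2)"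
        by (simp only: degree_mult_le)
      then show ?thesis using dR2[OF that, of x] by (simp add: L_def)
    qed
    \<comment> \<open>the degree bounds for both blocks of \<open>V\<close> exceed those for \<open>\<phi>\<close> by \<open>n + 4\<close>\<close>
    have const: "degree ([:x:] * p) \<le> k" if "degree p \<le> k" for x :: 'a and p k
      using degree_mult_le[of "[:x:]" p] that by simp
    have "degree (V lam \<kappa> (Inl i)) \<le> n + (n + 4)" for i
      unfolding V_def
    proof (intro degree_sum_le J(1) const)
      fix j assume "j \<in> J"
      from dR2[OF this, of "lam j"] show "degree (c lam \<kappa> j (Inl i)) \<le> n + (n + 4)"
        unfolding c_def sum.case by linarith
    qed
    moreover have "degree (V lam \<kappa> (Inr i)) \<le> (n + 1) + (n + 4)" for i
      unfolding V_def
    proof (intro degree_sum_le J(1) const)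
      fix j assume "j \<in> J"
      from dR2[OF this, of "lam j"] dQR[OF this, of "\<kappa> j"]
      show "degree (c lam \<kappa> j (Inr i)) \<le> (n + 1) + (n + 4)"
        unfolding c_def sum.case by (intro degree_add_le) linarith+
    qed
    ultimately have deg: "degree ?G \<le> n * nat d1 + (n + 1) * nat d2 + (n + 4) * r"
      by (intro degree_taylorP_le[OF F(1)] \<phi>)
    \<comment> \<open>\<open>2 * r\<close> from the double zero of the direction, and \<open>m j - r\<close> from the order at the marked point\<close>
    define E where "E j = 2 * r + nat (m j - int r)" for j
    have "L j ^ E j dvd ?G" if j: "j \<in> J" for j
    proof -
      define A1 where "A1 = [:lam j:] * R j ^ 2"
      define A2 where "A2 = [:lam j:] * R j ^ 2 + [:\<kappa> j:] * (Q * R j)"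
      define B where "B = - L j * ([:lam j:] * R j ^ 2)"
      \<comment> \<open>modulo the tangent vector with rescaling speeds \<open>A1\<close>, \<open>A2\<close> and speed \<open>B\<close> along the curve, \<open>V\<close> has a double zero at \<open>q j\<close>\<close>
      have "L j ^ 2 dvd V lam \<kappa> v - (case_sum (\<lambda>_. A1) (\<lambda>_. A2) v * \<phi> v + B * pderiv (\<phi> v))" for v
      proof -
        obtain \<psi> where \<psi>: "[:b j v:] = \<phi> v - L j * pderiv (\<phi> v) + L j ^ 2 * \<psi>"
          unfolding b_def L_def using linear_taylor_second_order by blast
        have "L j ^ 2 dvd [:b j v:] * c lam \<kappa> j v - (case_sum (\<lambda>_. A1) (\<lambda>_. A2) v * \<phi> v + B * pderiv (\<phi> v))"
        proof (cases v)
          case (Inl i)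
          have "[:b j v:] * c lam \<kappa> j v - (case_sum (\<lambda>_. A1) (\<lambda>_. A2) v * \<phi> v + B * pderiv (\<phi> v)) = L j ^ 2 * (A1 * \<psi>)"
            unfolding \<psi> by (simp add: Inl c_def A1_def B_def algebra_simps del: mult_pCons_left mult_pCons_right)
          then show ?thesis by simp
        next
          case (Inr i)
          have "[:b j v:] * c lam \<kappa> j v - (case_sum (\<lambda>_. A1) (\<lambda>_. A2) v * \<phi> v + B * pderiv (\<phi> v))
             = L j ^ 2 * (A2 * \<psi> - [:\<kappa> j:] * R j ^ 2 * pderiv (\<phi> v))"
            unfolding \<psi> by (simp add: Inr c_def A2_def B_def Q[OF j] algebra_simps power2_eq_square del: mult_pCons_left mult_pCons_right)
          then show ?thesis by simp
        qed
        moreover have "L j ^ 2 dvd (\<Sum>i\<in>J - {j}. [:b i v:] * c lam \<kappa> i v)"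
        proof (rule dvd_sum)
          fix i assume i: "i \<in> J - {j}"
          have "L j ^ 2 dvd R i ^ 2" using LR[of i j] i j by (intro dvd_power_same) auto
          moreover have "L j ^ 2 dvd Q * R i"
            unfolding power2_eq_square using LR[of i j] i j by (intro mult_dvd_mono) (auto simp: Q)
          ultimately have "L j ^ 2 dvd c lam \<kappa> i v"
            by (auto simp: c_def split: sum.splits intro!: dvd_add dvd_mult simp del: mult_pCons_left mult_pCons_right)
          then show "L j ^ 2 dvd [:b i v:] * c lam \<kappa> i v" by (rule dvd_mult)
        qed
        ultimately have "L j ^ 2 dvd ([:b j v:] * c lam \<kappa> j v - (case_sum (\<lambda>_. A1) (\<lambda>_. A2) v * \<phi> v + B * pderiv (\<phi> v)))
            + (\<Sum>i\<in>J - {j}. [:b i v:] * c lam \<kappa> i v)" by (rule dvd_add)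
        also have "\<dots> = V lam \<kappa> v - (case_sum (\<lambda>_. A1) (\<lambda>_. A2) v * \<phi> v + B * pderiv (\<phi> v))"
          unfolding V_def sum.remove[OF J(1) j] by (rule diff_add_eq)
        finally show ?thesis .
      qed
      then have "\<forall>v. \<exists>y. V lam \<kappa> v = L j ^ 2 * y + (case_sum (\<lambda>_. A1) (\<lambda>_. A2) v * \<phi> v + B * pderiv (\<phi> v))"
        by (metis dvd_def diff_add_cancel)
      then obtain Y where Y: "\<And>v. V lam \<kappa> v = L j ^ 2 * Y v + (case_sum (\<lambda>_. A1) (\<lambda>_. A2) v * \<phi> v + B * pderiv (\<phi> v))"
        by metis
      have "?G - L j ^ (2 * r) * taylorP F r \<phi> Y = 0"
      proof (rule poly_eq_0_of_cofinite_zeros[of "{}"])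
        fix s
        let ?x = "\<lambda>i. poly (\<phi> i) s"
        have "poly ?G s = taylorK F r ?x (\<lambda>i. poly (L j) s ^ 2 * poly (Y i) s
            + (bi_scale (poly A1 s) (poly A2 s) ?x i + poly B s * poly (pderiv (\<phi> i)) s))"
          unfolding poly_taylorP Y by (intro arg_cong[of _ _ "taylorK F r ?x"]) (auto simp: fun_eq_iff split: sum.splits)
        also have "\<dots> = taylorK F r ?x (\<lambda>i. poly (L j) s ^ 2 * poly (Y i) s)"
          by (rule taylor_tangent_cone[OF F(1) r])
        also have "\<dots> = (poly (L j) s ^ 2) ^ r * taylorK F r ?x (\<lambda>i. poly (Y i) s)"
          by (rule taylor_scale[OF is_ring_hom_ident])
        finally show "poly (?G - L j ^ (2 * r) * taylorP F r \<phi> Y) s = 0"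
          by (simp add: poly_taylorP power_mult)
      qed simp
      moreover have "L j ^ nat (m j - int r) dvd taylorP F r \<phi> Y"
        unfolding L_def by (rule dvd_taylorP[OF m[OF j]]) simp
      ultimately show ?thesis
        by (simp add: E_def power_add)
    qed
    then have "(\<Sum>j\<in>J. E j) \<le> degree ?G"
      unfolding L_def by (intro sum_root_orders_le_degree[OF J(1,3) ne])
    then have "int (\<Sum>j\<in>J. E j) \<le> int (n * nat d1 + (n + 1) * nat d2 + (n + 4) * r)"
      using deg by linarith
    also have "\<dots> = int n * d1 + (int n + 1) * d2 + (int n + 4) * int r"
      using F(2,3) by (simp add: algebra_simps)
    also have "\<dots> < (\<Sum>j\<in>J. m j) + (int n + 3) * int r"
      using less by (simp add: algebra_simps)
    also have "\<dots> = (\<Sum>j\<in>J. m j + int r)"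
      using J(2) by (simp add: sum.distrib)
    also have "\<dots> \<le> (\<Sum>j\<in>J. int (E j))"
      by (rule sum_mono) (auto simp: E_def)
    finally show False by simp
  qed
  \<comment> \<open>away from the marked parameters every direction has the form \<open>V\<close>\<close>
  have off: "taylorK F r (\<lambda>i. poly (\<phi> i) t) w = 0" if t: "t \<notin> q ` J" for t
  proof -
    obtain l1 where eq1: "\<And>i. i \<le> n \<Longrightarrow> w (Inl i) = (\<Sum>j\<in>J. l1 j * poly (\<phi> (Inl i)) (q j))"
      using span1[of "\<lambda>i. w (Inl i)"] by blast
    obtain l2 where eq2: "\<And>i. i \<le> Suc n \<Longrightarrow> w (Inr i) = (\<Sum>j\<in>J. l2 j * poly (\<phi> (Inr i)) (q j))"
      using span2[of "\<lambda>i. w (Inr i)"] by blast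
    have nz: "poly Q t \<noteq> 0" "poly (R j) t \<noteq> 0" for j
      using t J(1) by (auto simp: Q_def R_def L_def poly_prod)
    define lam where "lam j = l1 j / poly (R j) t ^ 2" for j
    define \<kappa> where "\<kappa> j = (l2 j - l1 j) / (poly Q t * poly (R j) t)" for j
    have l1: "l1 j = lam j * poly (R j) t ^ 2" for j
      using nz by (simp add: lam_def)
    have l2: "l2 j = lam j * poly (R j) t ^ 2 + \<kappa> j * (poly Q t * poly (R j) t)" for j
      using nz by (simp add: lam_def \<kappa>_def)
    have "poly (V lam \<kappa> (Inl i)) t = w (Inl i)" if "i \<le> n" for i
      unfolding V_def c_def eq1[OF that] by (simp add: poly_sum b_def l1 mult_ac)
    moreover have "poly (V lam \<kappa> (Inr i)) t = w (Inr i)" if "i \<le> Suc n" for i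
      unfolding V_def c_def eq2[OF that] by (simp add: poly_sum b_def l2 algebra_simps)
    ultimately have "taylorK F r (\<lambda>i. poly (\<phi> i) t) w = poly (taylorP F r \<phi> (V lam \<kappa>)) t"
      unfolding poly_taylorP by (intro taylor_cong[OF F(1)]) simp_all
    then show ?thesis by (simp add: G0)
  qed
  have "taylorP F r \<phi> (\<lambda>i. [:w i:]) = 0"
    using J(1) by (intro poly_eq_0_of_cofinite_zeros[of "q ` J"]) (simp_all add: poly_taylorP off)
  then have "poly (taylorP F r \<phi> (\<lambda>i. [:w i:])) t = 0" by simp
  then show ?thesis by (simp add: poly_taylorP)
qed

lemma ord_ge_nonpos: "m \<le> 0 \<Longrightarrow> ord_ge x F m"
  by (auto simp: ord_ge_def)

text \<open>
Induction on \<open>r\<close>: the vanishing of the terms of order less than \<open>r\<close> is what makes the term of order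
\<open>r\<close> well defined modulo tangent directions.
\<close>

lemma ord_ge_curve:
  fixes F :: "(nat + nat, 'a::field_char_0) mpoly" and \<phi> :: "nat + nat \<Rightarrow> 'a poly"
  assumes F: "bihomogeneous n d1 d2 F" "d1 \<ge> 0" "d2 \<ge> 0"
    and \<phi>: "\<And>i. degree (\<phi> (Inl i)) \<le> n" "\<And>j. degree (\<phi> (Inr j)) \<le> n + 1"
    and J: "finite J" "card J = n + 3" "inj_on q J"
    and m: "\<And>j. j \<in> J \<Longrightarrow> ord_ge (\<lambda>i. poly (\<phi> i) (q j)) F (m j)"
    and span1: "\<And>v :: nat \<Rightarrow> 'a. \<exists>lam. \<forall>i\<le>n. v i = (\<Sum>j\<in>J. lam j * poly (\<phi> (Inl i)) (q j))"
    and span2: "\<And>v :: nat \<Rightarrow> 'a. \<exists>lam. \<forall>i\<le>Suc n. v i = (\<Sum>j\<in>J. lam j * poly (\<phi> (Inr i)) (q j))"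
  shows "ord_ge (\<lambda>i. poly (\<phi> i) t) F ((\<Sum>j\<in>J. m j) - (int n * d1 + (int n + 1) * d2))"
    (is "ord_ge _ _ ?\<mu>")
proof -
  have "ord_ge (\<lambda>i. poly (\<phi> i) t) F (int r)" if "int r \<le> ?\<mu>" for r t
    using that
  proof (induction r arbitrary: t)
    case 0
    then show ?case by (simp add: ord_ge_nonpos)
  next
    case (Suc r)
    then have IH: "ord_ge (\<lambda>i. poly (\<phi> i) t) F (int r)" for t by simp
    have top: "taylorK F r (\<lambda>i. poly (\<phi> i) t) w = 0" for w
      using Suc.prems by (intro curve_leading_term_vanishes[OF F \<phi> J m span1 span2 IH]) simp_all
    show ?case
    proof (rule ord_geI)
      fix \<rho> w assume "int \<rho> < int (Suc r)"
      then consider "\<rho> = r" | "int \<rho> < int r" by linarith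
      then show "taylorK F \<rho> (\<lambda>i. poly (\<phi> i) t) w = 0"
        using top taylorK_eq_0[OF IH] by cases auto
    qed
  qed
  from this[of "nat ?\<mu>"] show ?thesis
    by (cases "?\<mu> \<ge> 0") (simp_all add: ord_ge_nonpos)
qed

section \<open>Closedness of the order condition\<close>

definition partial_deriv :: "'v \<Rightarrow> ('v, 'a::comm_ring_1) mpoly \<Rightarrow> ('v, 'a) mpoly"
  where "partial_deriv v F = (\<Sum>\<mu>\<in>keys F. single (\<mu> - single v (Suc 0)) (of_nat (lookup \<mu> v) * lookup F \<mu>))"

lemma lookup_partial_deriv: "lookup (partial_deriv v F) \<alpha> = of_nat (Suc (lookup \<alpha> v)) * lookup F (\<alpha> + single v (Suc 0))"
proof -
  let ?\<beta> = "\<alpha> + single v (Suc 0)"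
  have "lookup (partial_deriv v F) \<alpha> = (\<Sum>\<mu>\<in>keys F. if \<mu> = ?\<beta> then of_nat (Suc (lookup \<alpha> v)) * lookup F \<mu> else 0)"
    unfolding partial_deriv_def lookup_sum
  proof (rule sum.cong)
    fix \<mu>
    have "\<mu> = ?\<beta>" if "\<mu> - single v (Suc 0) = \<alpha>" "lookup \<mu> v \<noteq> 0"
      unfolding that(1)[symmetric] using that(2)
      by (intro poly_mapping_eqI) (auto simp: lookup_add lookup_minus lookup_single when_def)
    moreover have "lookup ?\<beta> v = Suc (lookup \<alpha> v)" "?\<beta> - single v (Suc 0) = \<alpha>"
      by (simp_all add: lookup_add)
    ultimately have iff: "\<mu> - single v (Suc 0) = \<alpha> \<and> lookup \<mu> v \<noteq> 0 \<longleftrightarrow> \<mu> = ?\<beta>"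
      by auto
    show "lookup (single (\<mu> - single v (Suc 0)) (of_nat (lookup \<mu> v) * lookup F \<mu>)) \<alpha>
        = (if \<mu> = ?\<beta> then of_nat (Suc (lookup \<alpha> v)) * lookup F \<mu> else 0)"
    proof (cases "\<mu> = ?\<beta>")
      case True
      then show ?thesis by (simp add: lookup_add)
    next
      case False
      then have "\<mu> - single v (Suc 0) \<noteq> \<alpha> \<or> lookup \<mu> v = 0" using iff by simp
      then show ?thesis using False by (auto simp: lookup_single_not_eq)
    qed
  qed simp
  also have "\<dots> = of_nat (Suc (lookup \<alpha> v)) * lookup F ?\<beta>"
    by (auto simp: in_keys_iff)
  finally show ?thesis .
qed

lemma partial_deriv_add: "partial_deriv v (F + G) = partial_deriv v F + partial_deriv v G"
  by (rule poly_mapping_eqI) (simp add: lookup_partial_deriv lookup_add algebra_simps del: of_nat_Suc)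

lemma partial_deriv_0 [simp]: "partial_deriv v 0 = 0"
  by (simp add: partial_deriv_def)

lemma partial_deriv_single: "partial_deriv v (single \<mu> c) = single (\<mu> - single v (Suc 0)) (of_nat (lookup \<mu> v) * c)"
  by (cases "c = 0") (simp_all add: partial_deriv_def)

lemma partial_deriv_mult: "partial_deriv v (F * G) = partial_deriv v F * G + F * partial_deriv v G"
proof (induction F rule: mpoly_induct)
  case (single \<mu> a)
  show ?case
  proof (induction G rule: mpoly_induct)
    case (single \<nu> b)
    have "\<mu> + \<nu> - single v (Suc 0) = (\<mu> - single v (Suc 0)) + \<nu>" if "lookup \<mu> v \<noteq> 0" for \<mu> \<nu>
    proof (rule poly_mapping_eqI)
      fix w show "lookup (\<mu> + \<nu> - single v (Suc 0)) w = lookup (\<mu> - single v (Suc 0) + \<nu>) w"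
        using that by (cases "w = v") (simp_all add: lookup_add lookup_minus lookup_single_not_eq)
    qed
    from this[of \<mu> \<nu>] this[of \<nu> \<mu>] show ?case
      by (cases "lookup \<mu> v = 0"; cases "lookup \<nu> v = 0")
        (simp_all add: mult_single partial_deriv_single lookup_add single_add[symmetric] algebra_simps)
  qed (simp_all add: partial_deriv_add algebra_simps)
qed (simp_all add: partial_deriv_add algebra_simps)

lemma partial_deriv_Const: "partial_deriv v (Const c) = 0"
  by (simp add: Const_def partial_deriv_single)

lemma partial_deriv_Var: "partial_deriv v (Var w) = (if v = w then 1 else 0)"
  by (auto simp: Var_def partial_deriv_single lookup_single)

lemma shift_partial_deriv: "shift x (partial_deriv v F) = partial_deriv v (shift x F)"
proof (induction F rule: mpoly_ring_induct)
  case (Const c)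
  then show ?case by (simp add: shift_def partial_deriv_Const msubst_Const[OF is_ring_hom_Const])
next
  case (Var w)
  have "shift x (1 :: ('a, 'b) mpoly) = 1" unfolding shift_def by (rule is_ring_homD(2)[OF is_ring_hom_msubst[OF is_ring_hom_Const]])
  then show ?case
    by (simp add: shift_def partial_deriv_Var msubst_Var[OF is_ring_hom_Const] partial_deriv_add partial_deriv_Const)
next
  case (add F G)
  then show ?case by (simp add: shift_def msubst_add[OF is_ring_hom_Const] partial_deriv_add)
next
  case (mult F G)
  then show ?case by (simp add: shift_def msubst_add[OF is_ring_hom_Const] msubst_mult[OF is_ring_hom_Const] partial_deriv_add partial_deriv_mult)
qed

lemma mdegree_add_single: "mdegree (\<alpha> + single v (Suc 0)) = Suc (mdegree \<alpha>)"
proof -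
  let ?A = "insert v (keys \<alpha>)"
  have m: "mdegree \<mu> = (\<Sum>w\<in>?A. lookup \<mu> w)" if "keys \<mu> \<subseteq> ?A" for \<mu>
    unfolding mdegree_def using that by (intro sum.mono_neutral_left) (auto simp: in_keys_iff)
  have "mdegree (\<alpha> + single v (Suc 0)) = (\<Sum>w\<in>?A. lookup \<alpha> w + (if w = v then 1 else 0))"
    by (subst m) (auto simp: in_keys_iff lookup_add lookup_single when_def intro!: sum.cong split: if_splits)
  also have "\<dots> = mdegree \<alpha> + 1"
    by (subst sum.distrib) (subst m, auto)
  finally show ?thesis by simp
qed

lemma lookup_shift_0: "lookup (shift x F) 0 = msubst (\<lambda>c. c) x F"
proof -
  have "msubst (\<lambda>c. c) x F = msubst (\<lambda>c. c) (\<lambda>i. 0) (shift x F)"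
    by (simp add: msubst_shift[OF is_ring_hom_ident])
  also have "\<dots> = (\<Sum>\<mu>\<in>insert 0 (keys (shift x F)). if \<mu> = 0 then lookup (shift x F) \<mu> else 0)"
  proof (subst msubst_superset[of "insert 0 (keys (shift x F))"], simp_all only: finite_insert finite_keys, blast, rule sum.cong)
    fix \<mu>
    show "lookup (shift x F) \<mu> * monomial_value (\<lambda>i. 0) \<mu> = (if \<mu> = 0 then lookup (shift x F) \<mu> else 0)"
    proof (cases "\<mu> = 0")
      case False
      then obtain v where "lookup \<mu> v \<noteq> 0" by (metis lookup_zero poly_mapping_eqI)
      then have "monomial_value (\<lambda>i. 0 :: 'a) \<mu> = 0"
        unfolding monomial_value_def by (intro prod_zero finite_keys bexI[of _ v]) (simp_all add: in_keys_iff zero_power)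
      then show ?thesis using False by simp
    qed simp
  qed simp
  also have "\<dots> = lookup (shift x F) 0" by simp
  finally show ?thesis ..
qed

text \<open>
This needs characteristic \<open>0\<close>: a nonconstant monomial is detected by one of its partial derivatives.
\<close>

lemma ord_ge_Suc_iff:
  fixes x :: "'v \<Rightarrow> 'a::field_char_0"
  shows "ord_ge x F (int (Suc k)) \<longleftrightarrow> msubst (\<lambda>c. c) x F = 0 \<and> (\<forall>v. ord_ge x (partial_deriv v F) (int k))"
proof (intro iffI conjI allI)
  assume F: "ord_ge x F (int (Suc k))"
  show "msubst (\<lambda>c. c) x F = 0"
    using F unfolding lookup_shift_0[symmetric] ord_ge_def by (force simp: in_keys_iff mdegree_def)
  show "ord_ge x (partial_deriv v F) (int k)" for v
    unfolding ord_ge_def shift_partial_deriv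
  proof
    fix \<alpha> assume "\<alpha> \<in> keys (partial_deriv v (shift x F))"
    then have "\<alpha> + single v (Suc 0) \<in> keys (shift x F)" by (auto simp: in_keys_iff lookup_partial_deriv)
    then show "int k \<le> int (mdegree \<alpha>)" using F by (force simp: ord_ge_def mdegree_add_single)
  qed
next
  assume F: "msubst (\<lambda>c. c) x F = 0 \<and> (\<forall>v. ord_ge x (partial_deriv v F) (int k))"
  show "ord_ge x F (int (Suc k))"
    unfolding ord_ge_def
  proof
    fix \<beta> assume \<beta>: "\<beta> \<in> keys (shift x F)"
    then have "\<beta> \<noteq> 0" using F by (auto simp: in_keys_iff lookup_shift_0)
    then obtain v where v: "lookup \<beta> v \<noteq> 0" by (metis lookup_zero poly_mapping_eqI)
    define \<alpha> where "\<alpha> = \<beta> - single v (Suc 0)"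
    have eq: "\<beta> = \<alpha> + single v (Suc 0)"
      unfolding \<alpha>_def using v by (intro poly_mapping_eqI) (auto simp: lookup_add lookup_minus lookup_single when_def)
    have "\<alpha> \<in> keys (shift x (partial_deriv v F))"
      using \<beta> unfolding shift_partial_deriv by (simp add: in_keys_iff lookup_partial_deriv eq del: of_nat_Suc)
    then have "k \<le> mdegree \<alpha>" using F unfolding ord_ge_def by force
    then show "int (Suc k) \<le> int (mdegree \<beta>)" by (simp add: eq mdegree_add_single)
  qed
qed

lemma ord_ge_1_iff:
  fixes x :: "'v \<Rightarrow> 'a::field_char_0"
  shows "ord_ge x F 1 \<longleftrightarrow> msubst id x F = 0"
  using ord_ge_Suc_iff[of x F 0] by (simp add: ord_ge_nonpos id_def)

lemma bihomogeneous_partial_deriv: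
  assumes "bihomogeneous n d1 d2 F"
  shows "\<exists>e1 e2. bihomogeneous n e1 e2 (partial_deriv v F)"
proof -
  have key: "\<alpha> + single v (Suc 0) \<in> keys F" if "\<alpha> \<in> keys (partial_deriv v F)" for \<alpha>
    using that by (auto simp: in_keys_iff lookup_partial_deriv)
  have sub: "keys \<alpha> \<subseteq> keys (\<alpha> + single v (Suc 0))" for \<alpha>
    by (auto simp: in_keys_iff lookup_add)
  have "v \<in> Inl ` {..n} \<union> Inr ` {..n + 1}" if "\<alpha> \<in> keys (partial_deriv v F)" for \<alpha>
  proof -
    have "v \<in> keys (\<alpha> + single v (Suc 0))" by (simp add: in_keys_iff lookup_add)
    then show ?thesis using assms key[OF that] unfolding bihomogeneous_def by blast
  qed
  note v = this
  have sums: "(\<Sum>i\<le>N. lookup (\<alpha> + single v (Suc 0)) (g i)) = (\<Sum>i\<le>N. lookup \<alpha> (g i)) + (if v \<in> g ` {..N} then 1 else 0)"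
    if "inj g" for \<alpha> N and g :: "nat \<Rightarrow> nat + nat"
  proof -
    have "(\<Sum>i\<le>N. lookup (single v (Suc 0)) (g i)) = (\<Sum>i\<in>g ` {..N}. if i = v then 1 else (0::nat))"
      using that by (subst sum.reindex) (auto simp: lookup_single when_def inj_on_def intro!: sum.cong)
    then show ?thesis by (auto simp: lookup_add sum.distrib)
  qed
  have "bihomogeneous n (d1 - (if v \<in> Inl ` {..n} then 1 else 0)) (d2 - (if v \<in> Inr ` {..n + 1} then 1 else 0)) (partial_deriv v F)"
    unfolding bihomogeneous_def
  proof (intro ballI conjI)
    fix \<alpha> assume \<alpha>: "\<alpha> \<in> keys (partial_deriv v F)"
    have F: "keys (\<alpha> + single v (Suc 0)) \<subseteq> Inl ` {..n} \<union> Inr ` {..n + 1}"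
      "int (\<Sum>i\<le>n. lookup (\<alpha> + single v (Suc 0)) (Inl i)) = d1"
      "int (\<Sum>j\<le>n + 1. lookup (\<alpha> + single v (Suc 0)) (Inr j)) = d2"
      using assms key[OF \<alpha>] unfolding bihomogeneous_def by blast+
    show "keys \<alpha> \<subseteq> Inl ` {..n} \<union> Inr ` {..n + 1}" using F(1) sub by blast
    show "int (\<Sum>i\<le>n. lookup \<alpha> (Inl i)) = d1 - (if v \<in> Inl ` {..n} then 1 else 0)"
      using F(2) unfolding sums[of Inl, OF inj_Inl] by (simp split: if_splits)
    show "int (\<Sum>j\<le>n + 1. lookup \<alpha> (Inr j)) = d2 - (if v \<in> Inr ` {..n + 1} then 1 else 0)"
      using F(3) unfolding sums[of Inr, OF inj_Inr] by (simp split: if_splits del: sum.atMost_Suc)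
  qed
  then show ?thesis by blast
qed

text \<open>
The point \<open>z\<close> satisfies all bihomogeneous equations of \<open>S\<close>.  By induction on the order, the iterated
partial derivatives of \<open>F\<close> are among these equations.  In this form the lemma serves the Zariski
closure and the strict transform alike.
\<close>

lemma ord_ge_of_vanishing:
  fixes F :: "(nat + nat, 'a::field_char_0) mpoly"
  assumes cl: "\<And>d1 d2 G. bihomogeneous n d1 d2 G \<Longrightarrow> (\<And>w. w \<in> S \<Longrightarrow> msubst id (coords w) G = 0) \<Longrightarrow> msubst id (coords z) G = 0"
    and F: "bihomogeneous n d1 d2 F" and S: "\<And>w. w \<in> S \<Longrightarrow> ord_ge (coords w) F m"
  shows "ord_ge (coords z) F m"
proof -
  have "ord_ge (coords z) F (int k)"
    if "bihomogeneous n d1 d2 F" "\<And>w. w \<in> S \<Longrightarrow> ord_ge (coords w) F (int k)" for k d1 d2 F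
    using that
  proof (induction k arbitrary: d1 d2 F)
    case (Suc k)
    obtain e where e: "\<And>v. \<exists>e2. bihomogeneous n (e v) e2 (partial_deriv v F)" using bihomogeneous_partial_deriv[OF Suc.prems(1)] by metis
    have "msubst id (coords z) F = 0"
      using Suc.prems(2) by (intro cl[OF Suc.prems(1)]) (simp add: ord_ge_Suc_iff id_def del: of_nat_Suc)
    moreover have "ord_ge (coords z) (partial_deriv v F) (int k)" for v
      using Suc.IH[of "e v"] e[of v] Suc.prems(2) by (auto simp: ord_ge_Suc_iff simp del: of_nat_Suc)
    ultimately show ?case by (simp add: ord_ge_Suc_iff id_def del: of_nat_Suc)
  qed (simp add: ord_ge_nonpos)
  from this[OF F, of "nat m"] S show ?thesis
    by (cases "m \<ge> 0") (simp_all add: ord_ge_nonpos)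
qed

lemma ord_ge_zariski_closure:
  fixes F :: "(nat + nat, 'a::field_char_0) mpoly"
  assumes "bihomogeneous n d1 d2 F" "\<And>w. w \<in> S \<Longrightarrow> ord_ge (coords w) F m" "z \<in> zariski_closure n S"
  shows "ord_ge (coords z) F m"
  using assms(3) by (intro ord_ge_of_vanishing[OF _ assms(1,2)]) (auto simp: zariski_closure_def)

text \<open>
A form \<open>G\<close> that vanishes on \<open>V\<close> defines, with coefficient \<open>0\<close> at all exceptional divisors, an effective
divisor whose support contains \<open>V\<close>.
\<close>

lemma ord_ge_strict_transform:
  fixes F :: "(nat + nat, 'a::field_char_0) mpoly"
  assumes "bihomogeneous n d1 d2 F" "\<And>w. w \<in> V \<Longrightarrow> ord_ge (coords w) F m" "Off z \<in> strict_transform n p V"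
  shows "ord_ge (coords z) F m"
proof (rule ord_ge_of_vanishing[OF _ assms(1,2)])
  fix d1 d2 G
  assume G: "bihomogeneous n d1 d2 G" "\<And>w. w \<in> V \<Longrightarrow> msubst id (coords w) G = 0"
  show "msubst id (coords z) G = 0"
  proof (cases "G = 0")
    case False
    have "effective n p (G, \<lambda>_. 0)" using False G by (auto simp: effective_def)
    moreover have mult: "mult_at p (G, \<lambda>_. 0) (Off w) \<ge> 1 \<longleftrightarrow> msubst id (coords w) G = 0" for w
      using ord_ge_iff_order_at[OF False, of "coords w" 1] by (simp add: ord_ge_1_iff)
    ultimately have "Off z \<in> supp n p (G, \<lambda>_. 0)"
      using assms(3) G(2) unfolding strict_transform_def supp_def by blast
    then show ?thesis using mult by (simp add: supp_def del: mult_at.simps)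
  qed simp
qed

text \<open>
Substituting \<open>\<epsilon>\<close> for \<open>s\<close> and a fixed direction for the other variables turns the equation in the
exceptional chart into the restriction of \<open>F\<close> to a line through \<open>p i\<close>.
\<close>

lemma ord_ge_of_effective:
  fixes F :: "(nat + nat, 'a::field_char_0) mpoly"
  assumes "effective n p (F, c)" "i \<in> {1..n + 3}"
  shows "ord_ge (coords (p i)) F (- c i)"
proof (cases "c i \<ge> 0")
  case False
  have "Var None ^ nat (- c i) dvd Var None ^ nat (c i) * exc_chart (p i) F"
    using assms unfolding effective_def by blast
  with False have "Var None ^ nat (- c i) dvd exc_chart (p i) F" by simp
  then obtain H where H: "exc_chart (p i) F = Var None ^ nat (- c i) * H" by (auto simp: dvd_def)
  show ?thesis
  proof (rule ord_geI)
    fix r and v :: "nat + nat \<Rightarrow> 'a" assume r: "int r < - c i"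
    let ?s = "msubst (\<lambda>c. [:c:]) (case_option [:0, 1:] (\<lambda>i. [:v i:]))"
    have "on_line (\<lambda>c. c) F (coords (p i)) v = ?s (exc_chart (p i) F)"
      unfolding exc_chart_def on_line_def msubst_msubst[OF is_ring_hom_pconst]
      by (simp add: msubst_add[OF is_ring_hom_pconst] msubst_mult[OF is_ring_hom_pconst] msubst_Const[OF is_ring_hom_pconst] msubst_Var[OF is_ring_hom_pconst])
    also have "\<dots> = monom 1 (nat (- c i)) * ?s H"
      unfolding H by (simp add: msubst_mult[OF is_ring_hom_pconst] is_ring_hom_power[OF is_ring_hom_msubst[OF is_ring_hom_pconst]] msubst_Var[OF is_ring_hom_pconst] monom_altdef)
    finally show "taylorK F r (coords (p i)) v = 0"
      using r by (simp add: taylor_def coeff_monom_mult)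
  qed
qed (simp add: ord_ge_nonpos)

section \<open>The distinguished curve\<close>

text \<open>
A vector outside the span of \<open>B\<close> would extend \<open>B\<close> to an independent set of \<open>N + 2\<close> elements in the
span of \<open>N + 1\<close> unit vectors.
\<close>

lemma coord_space_subset_span:
  fixes B :: "'a::field vec set"
  assumes "fv.independent B" "B \<subseteq> coord_space N" "card B = N + 1"
  shows "coord_space N \<subseteq> fv.span B"
proof -
  define e :: "nat \<Rightarrow> 'a vec" where "e i = (\<lambda>k. if k = i then 1 else 0)" for i
  have "inj_on e {..N}"
    by (rule inj_onI) (metis e_def zero_neq_one)
  then have card: "card (e ` {..N}) = N + 1" by (simp add: card_image)
  have sp: "coord_space N \<subseteq> fv.span (e ` {..N})"
  proof
    fix v :: "'a vec" assume v: "v \<in> coord_space N"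
    have "v = (\<Sum>i\<le>N. vscale (v i) (e i))"
    proof
      fix k
      have "(\<Sum>i\<le>N. vscale (v i) (e i)) k = (\<Sum>i\<le>N. vscale (v i) (e i) k)"
        by (induction N) simp_all
      also have "\<dots> = (\<Sum>i\<le>N. if i = k then v i else 0)"
        by (intro sum.cong) (auto simp: vscale_def e_def)
      also have "\<dots> = v k" using v by (auto simp: coord_space_def)
      finally show "v k = (\<Sum>i\<le>N. vscale (v i) (e i)) k" ..
    qed
    also have "\<dots> \<in> fv.span (e ` {..N})"
      by (intro fv.span_sum fv.span_scale fv.span_base) auto
    finally show "v \<in> fv.span (e ` {..N})" .
  qed
  have "finite B" using assms(3) by (simp add: card_ge_0_finite)
  show ?thesis
  proof (rule subsetI, rule ccontr)
    fix v assume v: "v \<in> coord_space N" "v \<notin> fv.span B"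
    then have "fv.independent (insert v B)"
      using assms(1) by (intro fv.independent_insertI)
    moreover have "insert v B \<subseteq> fv.span (e ` {..N})" using v(1) assms(2) sp by blast
    ultimately have "card (insert v B) \<le> card (e ` {..N})"
      using fv.independent_span_bound[of "e ` {..N}" "insert v B"] by blast
    moreover have "v \<notin> B" using v(2) fv.span_base by blast
    ultimately show False using card assms(3) \<open>finite B\<close> by simp
  qed
qed

lemma general_points_of_general_position:
  assumes gp: "general_position n p" and "distinct is" "set is \<subseteq> {1..n + 3}" "length is \<le> n + 1"
  shows "general_points (map p is)"
proof -
  have ext: "\<exists>js. distinct (is @ js) \<and> set (is @ js) \<subseteq> {1..n + 3} \<and> length (is @ js) = k" if "length is \<le> k" "k \<le> n + 3" for k
  proof -
    have "card ({1..n + 3} - set is) = n + 3 - length is"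
      using assms(2,3) by (simp add: card_Diff_subset distinct_card)
    then have "k - length is \<le> card ({1..n + 3} - set is)" using that by simp
    then obtain T where T: "T \<subseteq> {1..n + 3} - set is" "card T = k - length is"
      by (rule obtain_subset_with_card_n)
    have "finite T" using T(1) finite_subset by blast
    then obtain js where "set js = T" "distinct js" using finite_distinct_list by blast
    then show ?thesis using T that assms(2,3) by (intro exI[of _ js]) (auto simp: distinct_card[symmetric])
  qed
  have prefix: "lin_indep xs" if "lin_indep (xs @ ys)" for xs ys :: "'a vec list"
    using that fv.independent_mono[of "set (xs @ ys)" "set xs"] by (auto simp: lin_indep_def)
  obtain js where "distinct (is @ js)" "set (is @ js) \<subseteq> {1..n + 3}" "length (is @ js) = n + 1"
    using ext[of "n + 1"] assms(4) by auto
  then have "lin_indep (map (fst \<circ> p) (is @ js))"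
    using gp unfolding general_position_def by blast
  moreover obtain js' where "distinct (is @ js')" "set (is @ js') \<subseteq> {1..n + 3}" "length (is @ js') = n + 2"
    using ext[of "n + 2"] assms(4) by auto
  then have "lin_indep (map (snd \<circ> p) (is @ js'))"
    using gp unfolding general_position_def by blast
  ultimately show ?thesis
    unfolding general_points_def by (simp add: prefix)
qed

lemma not_proportional:
  assumes gp: "general_position n p" and n: "n \<ge> 1" and ij: "i \<in> {1..n + 3}" "j \<in> {1..n + 3}" "i \<noteq> j"
  shows "fst (p i) \<noteq> vscale c (fst (p j))" "snd (p i) \<noteq> vscale c (snd (p j))"
proof -
  have *: "a \<noteq> vscale c b" if "lin_indep [a, b]" for a b :: "'a vec"
  proof
    assume "a = vscale c b"
    then have "a \<in> fv.span {b}" by (auto intro: fv.span_scale fv.span_base)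
    then show False using that by (auto simp: lin_indep_def fv.independent_insert)
  qed
  have "general_points (map p [i, j])"
    using n ij by (intro general_points_of_general_position[OF gp]) auto
  then show "fst (p i) \<noteq> vscale c (fst (p j))" "snd (p i) \<noteq> vscale c (snd (p j))"
    by (auto simp: general_points_def dest: *)
qed

text \<open>
The sum runs over all \<open>M\<close> vectors so that the two factors can be treated with the same index set,
although they need different numbers of spanning vectors.
\<close>

lemma projections_span:
  fixes x :: "nat \<Rightarrow> 'a::field vec"
  assumes "N + 1 \<le> M" "lin_indep (map x [1..<N + 2])" "\<And>i. i \<in> {1..M} \<Longrightarrow> x i \<in> coord_space N"
  shows "\<exists>l. \<forall>i\<le>N. v i = (\<Sum>j\<in>{1..M}. l j * x j i)"
proof -
  let ?I = "{1..N + 1}"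
  have set: "set [1..<N + 2] = ?I" by (simp only: set_upt) auto
  have inj: "inj_on x ?I" and ind: "fv.independent (x ` ?I)"
    using assms(2) unfolding lin_indep_def distinct_map set_map set by auto
  have "coord_space N \<subseteq> fv.span (x ` ?I)"
    using assms(1,3) card_image[OF inj] by (intro coord_space_subset_span[OF ind]) auto
  moreover define v' where "v' = (\<lambda>i. if i \<le> N then v i else 0)"
  have "v' \<in> coord_space N" by (simp add: v'_def coord_space_def)
  ultimately have "v' \<in> fv.span (x ` ?I)" by blast
  then obtain u where "v' = (\<Sum>w\<in>x ` ?I. vscale (u w) w)"
    by (auto simp: fv.span_finite)
  then have v': "v' = (\<Sum>j\<in>?I. vscale (u (x j)) (x j))"
    by (simp only: sum.reindex[OF inj] comp_def)
  have ev: "(\<Sum>j\<in>A. f j) i = (\<Sum>j\<in>A. f j i)" for f :: "nat \<Rightarrow> 'a vec" and A i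
    by (induction A rule: infinite_finite_induct) simp_all
  have "v i = (\<Sum>j\<in>{1..M}. (if j \<le> N + 1 then u (x j) else 0) * x j i)" if "i \<le> N" for i
  proof -
    have "v i = (\<Sum>j\<in>?I. u (x j) * x j i)"
      using that arg_cong[OF v', of "\<lambda>w. w i"] by (simp add: ev vscale_def v'_def)
    also have "\<dots> = (\<Sum>j\<in>{1..M}. (if j \<le> N + 1 then u (x j) else 0) * x j i)"
      using assms(1) by (intro sum.mono_neutral_cong_left) auto
    finally show ?thesis .
  qed
  then show ?thesis by (intro exI[of _ "\<lambda>j. if j \<le> N + 1 then u (x j) else 0"]) simp
qed

lemma bin_forms_scale: "bin_forms N d f (k * x, k * y) = vscale (k ^ d) (bin_forms N d f (x, y))"
proof -
  have "k ^ j * k ^ (d - j) = k ^ d" if "j \<le> d" for j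
    using that by (simp add: power_add[symmetric])
  then show ?thesis
    by (auto simp: bin_forms_def vscale_def fun_eq_iff power_mult_distrib sum_distrib_left mult_ac intro!: sum.cong)
qed

text \<open>
The forms of a parametrized curve on the affine chart \<open>t \<mapsto> (t, 1 + b t)\<close> of the projective line,
which omits only the point \<open>(1, b)\<close>.
\<close>

definition aff_forms :: "nat \<Rightarrow> nat \<Rightarrow> (nat \<Rightarrow> nat \<Rightarrow> 'a::field) \<Rightarrow> 'a \<Rightarrow> nat \<Rightarrow> 'a poly"
  where "aff_forms N d f b i = (if i \<le> N then (\<Sum>j\<le>d. [:f i j:] * [:0, 1:] ^ j * [:1, b:] ^ (d - j)) else 0)"

lemma poly_aff_forms: "poly (aff_forms N d f b i) t = bin_forms N d f (t, 1 + b * t) i"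
  by (simp add: aff_forms_def bin_forms_def poly_sum mult_ac)

lemma degree_aff_forms: "degree (aff_forms N d f b i) \<le> d"
proof -
  have summand: "degree ([:f i j:] * [:0, 1:] ^ j * [:1, b:] ^ (d - j)) \<le> d" if "j \<le> d" for j
  proof -
    have "degree ([:f i j:] * [:0, 1:] ^ j * [:1, b:] ^ (d - j)) \<le> degree ([:f i j:] * [:0, 1:] ^ j) + degree ([:1, b:] ^ (d - j))"
      by (rule degree_mult_le)
    also have "degree ([:f i j:] * [:0, 1:] ^ j) \<le> degree [:f i j:] + degree ([:0, 1:] ^ j :: 'a poly)"
      by (rule degree_mult_le)
    also have "degree ([:0, 1:] ^ j :: 'a poly) \<le> degree ([:0, 1:] :: 'a poly) * j"
      by (rule degree_power_le)
    also have "degree ([:1, b:] ^ (d - j)) \<le> degree [:1, b:] * (d - j)"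
      by (rule degree_power_le)
    also have "degree [:1, b:] * (d - j) \<le> 1 * (d - j)" by (intro mult_right_mono) auto
    finally show ?thesis using that by simp
  qed
  show ?thesis
  proof (cases "i \<le> N")
    case True
    show ?thesis
      unfolding aff_forms_def if_P[OF True]
    proof (rule degree_sum_le)
      fix j assume "j \<in> {..d}"
      then show "degree ([:f i j:] * [:0, 1:] ^ j * [:1, b:] ^ (d - j)) \<le> d"
        by (intro summand) simp
    qed simp
  qed (simp add: aff_forms_def)
qed

text \<open>
A chart of the projective line is chosen that contains the parameters of all \<open>p i\<close> and of the given
point \<open>z\<close>; so the bound holds at every point of the curve.
\<close>

lemma ord_ge_rational_curve:
  fixes p :: "nat \<Rightarrow> 'a::field_char_0 point"
  assumes n: "n \<ge> 1" and gp: "general_position n p" and C: "distinguished_curve n p C"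
    and F: "bihomogeneous n d1 d2 F" "d1 \<ge> 0" "d2 \<ge> 0"
    and m: "\<And>i. i \<in> {1..n + 3} \<Longrightarrow> ord_ge (coords (p i)) F (m i)"
    and z: "z \<in> C"
  shows "ord_ge (coords z) F ((\<Sum>i = 1..n + 3. m i) - (int n * d1 + (int n + 1) * d2))"
proof -
  let ?J = "{1..n + 3}"
  obtain f g where C_eq: "C = {z. \<exists>q. q \<noteq> (0, 0) \<and> same_point z (bin_forms n n f q, bin_forms (n + 1) (n + 1) g q)}"
    using C unfolding distinguished_curve_def rational_curve_def Let_def by blast
  \<comment> \<open>the index \<open>0\<close> stands for the extra point \<open>z\<close>\<close>
  define p' where "p' i = (if i = 0 then z else p i)" for i
  have "p' i \<in> C" if "i \<in> insert 0 ?J" for i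
    using C z that by (auto simp: distinguished_curve_def p'_def)
  then have "\<forall>i\<in>insert 0 ?J. \<exists>q. q \<noteq> (0, 0) \<and> same_point (p' i) (bin_forms n n f q, bin_forms (n + 1) (n + 1) g q)"
    unfolding C_eq by blast
  then obtain q where q: "\<And>i. i \<in> insert 0 ?J \<Longrightarrow> q i \<noteq> (0, 0)"
    "\<And>i. i \<in> insert 0 ?J \<Longrightarrow> same_point (p' i) (bin_forms n n f (q i), bin_forms (n + 1) (n + 1) g (q i))"
    unfolding bchoice_iff by blast
  have "finite ((\<lambda>i. snd (q i) / fst (q i)) ` insert 0 ?J)" by simp
  from ex_new_if_finite[OF infinite_UNIV_char_0 this]
  obtain b where b: "b \<notin> (\<lambda>i. snd (q i) / fst (q i)) ` insert 0 ?J" by blast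
  \<comment> \<open>\<open>b\<close> avoids the slopes of all \<open>q i\<close>, so that every \<open>q i\<close> is a multiple of some \<open>(t i, 1 + b * t i)\<close>\<close>
  define \<kappa> where "\<kappa> i = snd (q i) - b * fst (q i)" for i
  define t where "t i = fst (q i) / \<kappa> i" for i
  have \<kappa>: "\<kappa> i \<noteq> 0" if "i \<in> insert 0 ?J" for i
  proof
    assume "\<kappa> i = 0"
    then have s: "snd (q i) = b * fst (q i)" by (simp add: \<kappa>_def)
    then have "fst (q i) \<noteq> 0" using q(1)[OF that] by (cases "q i") auto
    then have "b = snd (q i) / fst (q i)" using s by simp
    then show False using b that by blast
  qed
  have q_eq: "q i = (\<kappa> i * t i, \<kappa> i * (1 + b * t i))" if "i \<in> insert 0 ?J" for i
    using \<kappa>[OF that] by (cases "q i") (simp add: t_def \<kappa>_def field_simps)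
  define \<phi> where "\<phi> = case_sum (aff_forms n n f b) (aff_forms (n + 1) (n + 1) g b)"
  let ?x = "\<lambda>i v. poly (\<phi> v) (t i)"
  have "\<exists>c e. c \<noteq> 0 \<and> e \<noteq> 0 \<and> coords (p' i) = bi_scale c e (?x i)" if i: "i \<in> insert 0 ?J" for i
  proof -
    obtain c e where ce: "c \<noteq> 0" "e \<noteq> 0" "fst (p' i) = vscale c (bin_forms n n f (q i))"
      "snd (p' i) = vscale e (bin_forms (n + 1) (n + 1) g (q i))"
      using q(2)[OF i] by (auto simp: same_point_def)
    have "coords (p' i) = bi_scale (c * \<kappa> i ^ n) (e * \<kappa> i ^ (n + 1)) (?x i)"
      unfolding ce(3,4) q_eq[OF i] bin_forms_scale
      by (auto simp: bi_scale_def \<phi>_def poly_aff_forms vscale_def fun_eq_iff split: sum.splits)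
    then show ?thesis using ce(1,2) \<kappa>[OF i] by (intro exI conjI) auto
  qed
  then have "\<forall>i\<in>insert 0 ?J. \<exists>c e. c \<noteq> 0 \<and> e \<noteq> 0 \<and> coords (p' i) = bi_scale c e (?x i)" by blast
  then obtain c e where ce: "\<And>i. i \<in> insert 0 ?J \<Longrightarrow> c i \<noteq> 0" "\<And>i. i \<in> insert 0 ?J \<Longrightarrow> e i \<noteq> 0"
    and p': "\<And>i. i \<in> insert 0 ?J \<Longrightarrow> coords (p' i) = bi_scale (c i) (e i) (?x i)"
    unfolding bchoice_iff by blast
  have fst_p: "fst (p i) k = c i * ?x i (Inl k)" and snd_p: "snd (p i) k = e i * ?x i (Inr k)" if "i \<in> ?J" for i k
    using fun_cong[OF p'[of i], of "Inl k"] fun_cong[OF p'[of i], of "Inr k"] that by (auto simp: p'_def)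
  have x: "?x i = bi_scale (1 / c i) (1 / e i) (coords (p i))" if "i \<in> ?J" for i
    using ce[of i] that by (auto simp: fun_eq_iff bi_scale_def fst_p snd_p split: sum.splits)
  have "inj_on t ?J"
  proof (rule inj_onI, rule ccontr)
    fix i j assume ij: "i \<in> ?J" "j \<in> ?J" "t i = t j" "i \<noteq> j"
    have "fst (p i) = vscale (c i / c j) (fst (p j))"
      using ij(3) ce(1)[of j] ij(2) by (auto simp: fun_eq_iff vscale_def fst_p[OF ij(1)] fst_p[OF ij(2)])
    then show False using not_proportional(1)[OF gp n ij(1,2,4)] by blast
  qed
  moreover have "ord_ge (?x i) F (m i)" if "i \<in> ?J" for i
    unfolding x[OF that] by (rule ord_ge_bi_scale[OF F(1) m[OF that]])
  moreover
  have "p i \<in> PP n" if "i \<in> ?J" for i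
    using gp that unfolding general_position_def by blast
  then have PP: "fst (p i) \<in> coord_space n" "snd (p i) \<in> coord_space (n + 1)" if "i \<in> ?J" for i
    using that by (auto simp: PP_def mem_Times_iff)
  have gp1: "lin_indep (map (fst \<circ> p) js)" if "distinct js" "set js \<subseteq> ?J" "length js = n + 1" for js
    using gp that unfolding general_position_def by blast
  have gp2: "lin_indep (map (snd \<circ> p) js)" if "distinct js" "set js \<subseteq> ?J" "length js = n + 2" for js
    using gp that unfolding general_position_def by blast
  have "\<exists>l. \<forall>k\<le>n. v k = (\<Sum>j\<in>?J. l j * poly (\<phi> (Inl k)) (t j))" for v
  proof -
    have "lin_indep (map (fst \<circ> p) [1..<n + 2])"
      by (rule gp1) (simp_all del: upt_Suc add: subset_iff)
    then obtain l where l: "\<And>k. k \<le> n \<Longrightarrow> v k = (\<Sum>j\<in>?J. l j * (fst \<circ> p) j k)"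
      using projections_span[of n "n + 3" "fst \<circ> p" v] PP by auto
    show ?thesis
      by (rule exI[of _ "\<lambda>j. l j * c j"]) (auto simp: l fst_p mult.assoc intro!: sum.cong)
  qed
  moreover have "\<exists>l. \<forall>k\<le>Suc n. v k = (\<Sum>j\<in>?J. l j * poly (\<phi> (Inr k)) (t j))" for v
  proof -
    have "lin_indep (map (snd \<circ> p) [1..<n + 1 + 2])"
      by (rule gp2) (simp_all del: upt_Suc add: subset_iff)
    then obtain l where l: "\<And>k. k \<le> n + 1 \<Longrightarrow> v k = (\<Sum>j\<in>?J. l j * (snd \<circ> p) j k)"
      using projections_span[of "n + 1" "n + 3" "snd \<circ> p" v] PP by auto
    show ?thesis
      by (rule exI[of _ "\<lambda>j. l j * e j"]) (auto simp: l snd_p mult.assoc intro!: sum.cong)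
  qed
  ultimately have "ord_ge (?x 0) F ((\<Sum>i\<in>?J. m i) - (int n * d1 + (int n + 1) * d2))"
    by (intro ord_ge_curve[OF F]) (auto simp: \<phi>_def degree_aff_forms)
  from ord_ge_bi_scale[OF F(1) this, of "c 0" "e 0"] show ?thesis
    using p'[of 0] by (simp add: p'_def)
qed

section \<open>Bilinear joins\<close>

text \<open>
The bound holds on each of the spans whose union is dense in the join, and it passes to the closure.
\<close>

lemma ord_ge_bilinear_join:
  fixes F :: "(nat + nat, 'a::field_char_0) mpoly"
  assumes F: "bihomogeneous n d1 d2 F" "d1 \<ge> 0" "d2 \<ge> 0"
    and X: "list_all2 (\<lambda>X a. \<forall>z\<in>X. ord_ge (coords z) F a) Xs as" and z: "z \<in> BJ n Xs"
  shows "ord_ge (coords z) F (sum_list as - (int (length Xs) - 1) * (d1 + d2))"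
proof (rule ord_ge_zariski_closure[OF F(1) _ z[unfolded BJ_def]])
  fix w assume "w \<in> (\<Union>zs\<in>{zs. list_all2 (\<in>) zs Xs \<and> general_points zs}. BL zs)"
  then obtain zs where zs: "list_all2 (\<in>) zs Xs" "w \<in> BL zs" by auto
  have "list_all2 (\<lambda>z a. ord_ge (coords z) F a) zs as"
    by (rule list_all2_trans[OF _ zs(1) X]) simp
  then show "ord_ge (coords w) F (sum_list as - (int (length Xs) - 1) * (d1 + d2))"
    using ord_ge_span[OF F, of zs "as" "fst w" "snd w"] zs(2) list_all2_lengthD[OF zs(1)]
    by (auto simp: BL_def mem_Times_iff)
qed

lemma closure_superset: "S \<inter> PP n \<subseteq> zariski_closure n S"
  by (auto simp: zariski_closure_def)

lemma BJ_memI: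
  assumes "list_all2 (\<in>) zs Xs" "general_points zs" "z \<in> BL zs \<inter> PP n"
  shows "z \<in> BJ n Xs"
  unfolding BJ_def
proof (rule subsetD[OF closure_superset], rule IntI)
  show "z \<in> (\<Union>zs\<in>{zs. list_all2 (\<in>) zs Xs \<and> general_points zs}. BL zs)"
    using assms by (intro UN_I[of zs]) simp_all
qed (use assms in simp)

lemma BL_mem:
  assumes "z \<in> set zs" "w \<in> set zs" "z \<in> PP n" "w \<in> PP n"
  shows "(fst z, snd w) \<in> BL zs \<inter> PP n"
  using assms by (auto simp: BL_def PP_def mem_Times_iff intro: fv.span_base)

text \<open>
The multiplicity of a divisor is controlled at points off the exceptional divisors, so the join must
contain such a point.  For \<open>i\<close> in \<open>idx\<close> and \<open>j \<noteq> i\<close>, the point with the first projection of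
\<open>p j\<close> and the second projection of \<open>p i\<close> is one.
\<close>

lemma join_contains_other_point:
  fixes p :: "nat \<Rightarrow> 'a::field_char_0 point"
  assumes n: "n \<ge> 1" and gp: "general_position n p" and C: "distinguished_curve n p C"
    and k: "1 \<le> k" "k \<le> n + 1" and idx: "idx \<noteq> []" "set idx \<subseteq> {1..n + 3}"
  shows "\<exists>z \<in> BJ n [BS n k C, BL (map p idx)]. z \<in> PP n \<and> (\<forall>i\<in>{1..n + 3}. \<not> same_point z (p i))"
proof -
  have PP: "p i \<in> PP n" if "i \<in> {1..n + 3}" for i
    using gp that unfolding general_position_def by blast
  define i where "i = hd idx"
  have i: "i \<in> set idx" using idx(1) by (simp add: i_def)
  then have i': "i \<in> {1..n + 3}" using idx(2) by blast
  define j where "j = (if i = 1 then 2 else (1 :: nat))"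
  have j: "j \<in> {1..n + 3}" "j \<noteq> i" by (auto simp: j_def)
  \<comment> \<open>\<open>k\<close> of the marked points, one of them \<open>p j\<close>; being at most \<open>n + 1\<close>, they are independent in both factors\<close>
  define js where "js = j # take (k - 1) (filter (\<lambda>x. x \<noteq> j) [1..<n + 4])"
  have fl: "length (filter (\<lambda>x. x \<noteq> j) [1..<n + 4]) = n + 2"
  proof -
    have "length (filter (\<lambda>x. x \<noteq> j) [1..<n + 4]) = card ({1..<n + 4} - {j})"
      by (subst distinct_card[symmetric]) (auto intro!: arg_cong[of _ _ card] simp del: upt_Suc)
    also have "\<dots> = n + 2" using j(1) by simp
    finally show ?thesis .
  qed
  have js: "distinct js" "set js \<subseteq> {1..n + 3}" "length js = k" "j \<in> set js"
    using j(1) k fl by (auto simp: js_def simp del: upt_Suc dest!: in_set_takeD)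
  have C_mem: "p i \<in> C" if "i \<in> {1..n + 3}" for i
    using C that by (auto simp: distinguished_curve_def)
  have "p j \<in> BS n k C"
  proof -
    have "list_all2 (\<in>) (map p js) (replicate k C)"
    proof -
      have "\<forall>x\<in>set js. p x \<in> C" using js(2) C_mem by blast
      then show ?thesis using js(3) by (auto simp: list_all2_conv_all_nth)
    qed
    moreover have "general_points (map p js)"
      using js k by (intro general_points_of_general_position[OF gp]) auto
    moreover have "p j \<in> BL (map p js) \<inter> PP n"
      using BL_mem[of "p j" "map p js" "p j"] js(4) PP[OF j(1)] by auto
    ultimately show ?thesis
      unfolding BS_def by (rule BJ_memI)
  qed
  moreover have "p i \<in> BL (map p idx)"
    using BL_mem[of "p i" "map p idx" "p i"] i PP[OF i'] by auto
  ultimately have "list_all2 (\<in>) [p j, p i] [BS n k C, BL (map p idx)]" by simp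
  moreover have "general_points (map p [j, i])"
    using n i' j by (intro general_points_of_general_position[OF gp]) auto
  then have "general_points [p j, p i]" by simp
  moreover have z: "(fst (p j), snd (p i)) \<in> BL [p j, p i] \<inter> PP n"
    using PP[OF i'] PP[OF j(1)] by (intro BL_mem) auto
  ultimately have "(fst (p j), snd (p i)) \<in> BJ n [BS n k C, BL (map p idx)]"
    by (rule BJ_memI)
  moreover have "\<not> same_point (fst (p j), snd (p i)) (p s)" if s: "s \<in> {1..n + 3}" for s
  proof
    assume "same_point (fst (p j), snd (p i)) (p s)"
    then obtain c e where ce: "fst (p j) = vscale c (fst (p s))" "snd (p i) = vscale e (snd (p s))"
      by (auto simp: same_point_def)
    have "s = j" using not_proportional(1)[OF gp n j(1) s] ce(1) by blast
    moreover have "s = i" using not_proportional(2)[OF gp n i' s] ce(2) by blast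
    ultimately show False using j(2) by simp
  qed
  ultimately show ?thesis using z by blast
qed

theorem proposition4p7:
  fixes p :: "nat \<Rightarrow> 'a::{alg_closed_field, field_char_0} point"
    and C :: "'a point set"
    and n k l :: nat
    and idx :: "nat list"
    and d1 d2 :: int
    and m :: "nat \<Rightarrow> int"
  assumes "n \<ge> 1"
    and "general_position n p"
    and "distinguished_curve n p C"
    and "1 \<le> k" and "k \<le> n + 1"
    and "1 \<le> l" and "l \<le> n + 1"
    and "length idx = l" and "distinct idx" and "set idx \<subseteq> {1..n + 3}"
    and "linear_system n p d1 d2 m \<noteq> {}"
  shows "in_base_locus_at_least n p d1 d2 m
           (strict_transform n p (BJ n [BS n k C, BL (map p idx)]))
           (max 0 (int k * (\<Sum>i = 1..n + 3. m i) + (\<Sum>j<l. m (idx ! j))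
                   - (int n * int k + int k + int l - 1) * d1
                   - (int n * int k + 2 * int k + int l - 1) * d2))"
proof -
  let ?V = "BJ n [BS n k C, BL (map p idx)]"
  let ?Y = "strict_transform n p ?V"
  let ?T = "d1 + d2"
  define M where "M = (\<Sum>i = 1..n + 3. m i) - (int n * d1 + (int n + 1) * d2)"
  define B where "B = (\<Sum>j<l. m (idx ! j)) - (int l - 1) * ?T"
  have "mult_along_ge n p \<Delta> ?Y (max 0 (int k * M - (int k - 1) * ?T + B - ?T))"
    if "\<Delta> \<in> linear_system n p d1 d2 m" for \<Delta>
  proof -
    obtain F c where \<Delta>: "\<Delta> = (F, c)" and eff: "effective n p (F, c)"
      and F: "bihomogeneous n d1 d2 F" and c: "\<And>i. i \<in> {1..n + 3} \<Longrightarrow> c i = - m i"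
      using \<open>\<Delta> \<in> linear_system n p d1 d2 m\<close> by (auto simp: linear_system_def)
    have ne: "F \<noteq> 0" using eff by (simp add: effective_def)
    then obtain \<mu> where "\<mu> \<in> keys F" by (metis in_keys_iff lookup_zero poly_mapping_eqI)
    from bihomogeneousD(4,5)[OF F this] have d: "d1 \<ge> 0" "d2 \<ge> 0" .
    have p: "ord_ge (coords (p i)) F (m i)" if "i \<in> {1..n + 3}" for i
      using ord_ge_of_effective[OF eff that] c[OF that] by simp
    have C: "ord_ge (coords z) F M" if "z \<in> C" for z
      unfolding M_def by (rule ord_ge_rational_curve[OF assms(1,2,3) F d p that])
    have BS: "ord_ge (coords z) F (int k * M - (int k - 1) * ?T)" if "z \<in> BS n k C" for z
      using ord_ge_bilinear_join[OF F d, of "replicate k C" "replicate k M"] that C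
      by (auto simp: BS_def list_all2_conv_all_nth sum_list_replicate)
    have BL: "ord_ge (coords z) F B" if "z \<in> BL (map p idx)" for z
    proof -
      have "list_all2 (\<lambda>z a. ord_ge (coords z) F a) (map p idx) (map m idx)"
        unfolding list_all2_map1 list_all2_map2 list_all2_same using assms(10) p by blast
      moreover have "sum_list (map m idx) = (\<Sum>j<l. m (idx ! j))"
        using assms(8) by (simp add: sum_list_sum_nth atLeast0LessThan)
      ultimately show ?thesis
        using ord_ge_span[OF F d, of "map p idx" "map m idx" "fst z" "snd z"] that assms(8)
        by (auto simp: BL_def mem_Times_iff B_def)
    qed
    have V: "ord_ge (coords z) F (int k * M - (int k - 1) * ?T + B - ?T)" if "z \<in> ?V" for z
      using ord_ge_bilinear_join[OF F d, of "[BS n k C, BL (map p idx)]" "[int k * M - (int k - 1) * ?T, B]"] BS BL that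
      by (simp add: algebra_simps)
    \<comment> \<open>the sum of all exceptional divisors; off its support only points of the product remain\<close>
    let ?E = "(1, \<lambda>_. 1) :: 'a bdivisor"
    have one: "(1 :: (nat + nat, 'a) mpoly) = Const 1" by (simp add: Const_def)
    have "bihomogeneous n 0 0 (1 :: (nat + nat, 'a) mpoly)" by (simp add: bihomogeneous_def)
    then have "effective n p ?E" unfolding effective_def by auto
    moreover have off: "Off z \<notin> supp n p ?E" for z
    proof -
      have "\<not> ord_ge (coords z) (1 :: (nat + nat, 'a) mpoly) 1"
        unfolding ord_ge_1_iff one msubst_Const[OF is_ring_hom_id] by simp
      then show ?thesis using ord_ge_iff_order_at[of "1 :: (nat + nat, 'a) mpoly" "coords z" 1]
        by (simp add: supp_def)
    qed
    moreover have "\<not> ?Y \<subseteq> supp n p ?E"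
    proof -
      obtain z where "z \<in> ?V" "z \<in> PP n" "\<forall>i\<in>{1..n + 3}. \<not> same_point z (p i)"
        using join_contains_other_point[OF assms(1,2,3,4,5), of idx] assms(6,8,10) by fastforce
      then have "Off z \<in> ?Y" unfolding strict_transform_def blowup_def by blast
      then show ?thesis using off by blast
    qed
    moreover have "max 0 (int k * M - (int k - 1) * ?T + B - ?T) \<le> mult_at p \<Delta> \<xi>" if \<xi>: "\<xi> \<in> ?Y - supp n p ?E" for \<xi>
    proof (cases \<xi>)
      case (Off z)
      then have "ord_ge (coords z) F (int k * M - (int k - 1) * ?T + B - ?T)"
        using \<xi> by (intro ord_ge_strict_transform[OF F V, where p = p]) blast+
      then show ?thesis by (simp add: Off \<Delta> ord_ge_iff_order_at[OF ne])
    next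
      case (Exc i v)
      have "mult_at p ?E \<xi> \<ge> 1" by (simp add: Exc)
      moreover have "\<xi> \<in> blowup n p" using \<xi> by (simp add: strict_transform_def)
      ultimately show ?thesis using \<xi> by (simp add: supp_def)
    qed
    ultimately show ?thesis unfolding mult_along_ge_def by blast
  qed
  moreover have "int k * M - (int k - 1) * ?T + B - ?T
      = int k * (\<Sum>i = 1..n + 3. m i) + (\<Sum>j<l. m (idx ! j))
        - (int n * int k + int k + int l - 1) * d1 - (int n * int k + 2 * int k + int l - 1) * d2"
    unfolding M_def B_def by (simp add: algebra_simps)
  ultimately show ?thesis
    unfolding in_base_locus_at_least_def by simp
qed

end
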